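(* Let $k$ be a field, let $Q$ be a finite quiver without sources, and let $A=kQ/J^2$ be the corresponding algebra with radical square zero. Then the projective Leavitt complex $\mathcal{P}^{\bullet}$ of $Q$ is an acyclic complex.
   Context: **Quivers and the algebra $A$.** A quiver $Q=(Q_0,Q_1;s,t)$ has vertex set $Q_0$, arrow set $Q_1$, and start/terminal maps $s,t$; it is finite if $Q_0,Q_1$ are finite, and has no sources if every vertex is the terminal vertex of some arrow. A path of length $l(p)=m\ge 1$ is $p=\alpha_m\cdots\alpha_1$ with $t(\alpha_r)=s(\alpha_{r+1})$ (written right to left), $s(p)=s(\alpha_1)$, $t(p)=t(\alpha_m)$; trivial paths $e_i$ have length $0$ and $s(e_i)=t(e_i)=i$. For $m\geq2$ put $\widehat p=\alpha_{m-1}\cdots\alpha_1$; for an arrow $\alpha$ put $\widehat\alpha=e_{s(\alpha)}$. $kQ$ is the path algebra ($pq$ is concatenation if $s(p)=t(q)$, else $0$), $J$ the ideal generated by arrows, $A=kQ/J^2$ with basis $\{e_i\}\cup Q_1$. $P_i=Ae_i$ has basis $e_i$ and the arrows starting at $i$. **Associated pairs.** For each vertex $i$ fix one arrow terminating at $i$, called the associated arrow terminating at $i$. For paths $p=\alpha_m\cdots\alpha_1$, $q=\beta_n\cdots\beta_1$ with $m,n\ge1$, $(p,q)$ is an associated pair if $s(p)=s(q)$ and either $\alpha_1\ne\beta_1$, or $\alpha_1=\beta_1$ is not associated; also $(p,e_{s(p)})$ and $(e_{s(p)},p)$ are associated pairs for all paths $p$. $\mathbf{\Lambda}^l_i$ is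 the set of associated pairs $(p,q)$ with $l(q)-l(p)=l$, $t(p)=i$. **Projective Leavitt complex.** For a set $X$ and module $M$, $M^{(X)}=\bigoplus_{x\in X}M\zeta_x$ with each $M\zeta_x$ a copy of $M$. $\mathcal P^\bullet=(\mathcal P^l,\delta^l)_{l\in\mathbb Z}$ has $\mathcal{P}^l=\bigoplus_{i\in Q_0}P_i^{(\mathbf{\Lambda}^l_i)}$, and $\delta^l:\mathcal P^l\to\mathcal P^{l+1}$ is given, for $(p,q)\in\mathbf{\Lambda}^l_i$ and $\alpha\in Q_1$ with $s(\alpha)=i$, by $\delta^l(\alpha\zeta_{(p,q)})=0$; $\delta^l(e_i\zeta_{(p,q)})=\beta\zeta_{(\widehat p,q)}$ if $p=\beta\widehat p$ with $\beta\in Q_1$, and $=\sum_{\beta\in Q_1,\,t(\beta)=i}\beta\zeta_{(e_{s(\beta)},q\beta)}$ if $l(p)=0$. *)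

theory Defs
  imports "HOL-Algebra.Algebra" "HOL-Library.Poly_Mapping" "Graph_Theory.Arc_Walk"
begin

section \<open>Left modules over a not necessarily commutative ring\<close>

text \<open>The locale \<^locale>\<open>module\<close> of HOL-Algebra requires a commutative ring of scalars.\<close>

locale left_module = R?: ring R + M?: abelian_group M
  for R :: "('a, 'r) ring_scheme" (structure) and M :: "('a, 'm, 'x) module_scheme" (structure) +
  assumes smult_closed: "\<lbrakk>a \<in> carrier R; x \<in> carrier M\<rbrakk> \<Longrightarrow> a \<odot>\<^bsub>M\<^esub> x \<in> carrier M"
    and smult_l_distr: "\<lbrakk>a \<in> carrier R; b \<in> carrier R; x \<in> carrier M\<rbrakk> \<Longrightarrow>
      (a \<oplus> b) \<odot>\<^bsub>M\<^esub> x = a \<odot>\<^bsub>M\<^esub> x \<oplus>\<^bsub>M\<^esub> b \<odot>\<^bsub>M\<^esub> x"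
    and smult_r_distr: "\<lbrakk>a \<in> carrier R; x \<in> carrier M; y \<in> carrier M\<rbrakk> \<Longrightarrow>
      a \<odot>\<^bsub>M\<^esub> (x \<oplus>\<^bsub>M\<^esub> y) = a \<odot>\<^bsub>M\<^esub> x \<oplus>\<^bsub>M\<^esub> a \<odot>\<^bsub>M\<^esub> y"
    and smult_assoc1: "\<lbrakk>a \<in> carrier R; b \<in> carrier R; x \<in> carrier M\<rbrakk> \<Longrightarrow>
      (a \<otimes> b) \<odot>\<^bsub>M\<^esub> x = a \<odot>\<^bsub>M\<^esub> (b \<odot>\<^bsub>M\<^esub> x)"
    and smult_one: "x \<in> carrier M \<Longrightarrow> \<one> \<odot>\<^bsub>M\<^esub> x = x"

text \<open>Additive maps commuting with the scalars in \<open>S\<close>: for \<open>S\<close> the whole carrier of the ring \<open>A\<close>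
  these are the \<open>A\<close>-module homomorphisms, for \<open>S\<close> the image of the field \<open>k\<close> in \<open>A\<close> the \<open>k\<close>-linear
  maps.\<close>

definition linear_maps ::
    "'a set \<Rightarrow> ('a, 'm, 'x) module_scheme \<Rightarrow> ('a, 'n, 'y) module_scheme \<Rightarrow> ('m \<Rightarrow> 'n) set"
  where "linear_maps S M N =
    {f \<in> Pi (carrier M) (\<lambda>_. carrier N).
      (\<forall>x\<in>carrier M. \<forall>y\<in>carrier M. f (x \<oplus>\<^bsub>M\<^esub> y) = f x \<oplus>\<^bsub>N\<^esub> f y) \<and>
      (\<forall>a\<in>S. \<forall>x\<in>carrier M. f (a \<odot>\<^bsub>M\<^esub> x) = a \<odot>\<^bsub>N\<^esub> f x)}"

text \<open>The fields \<^const>\<open>monoid.mult\<close> and \<^const>\<open>monoid.one\<close> of a module record carry no meaning.\<close>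

definition direct_sum ::
    "'i set \<Rightarrow> ('i \<Rightarrow> ('a, 'm, 'x) module_scheme) \<Rightarrow> ('a, 'i \<Rightarrow> 'm) module"
  where "direct_sum I M =
    \<lparr>carrier = {x \<in> \<Pi>\<^sub>E i\<in>I. carrier (M i). finite {i \<in> I. x i \<noteq> \<zero>\<^bsub>M i\<^esub>}},
     monoid.mult = undefined, one = undefined,
     ring.zero = (\<lambda>i\<in>I. \<zero>\<^bsub>M i\<^esub>), ring.add = (\<lambda>x y. \<lambda>i\<in>I. x i \<oplus>\<^bsub>M i\<^esub> y i),
     smult = (\<lambda>a x. \<lambda>i\<in>I. a \<odot>\<^bsub>M i\<^esub> x i)\<rparr>"

definition direct_sum_inj ::
    "'i set \<Rightarrow> ('i \<Rightarrow> ('a, 'm, 'x) module_scheme) \<Rightarrow> 'i \<Rightarrow> 'm \<Rightarrow> 'i \<Rightarrow> 'm"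
  where "direct_sum_inj I M i m = (\<lambda>j\<in>I. if j = i then m else \<zero>\<^bsub>M j\<^esub>)"

text \<open>The left module \<open>R e\<close>.\<close>

definition principal_left_module :: "('a, 'x) ring_scheme \<Rightarrow> 'a \<Rightarrow> ('a, 'a) module"
  where "principal_left_module R e =
    \<lparr>carrier = {a \<otimes>\<^bsub>R\<^esub> e | a. a \<in> carrier R},
     monoid.mult = undefined, one = undefined,
     ring.zero = \<zero>\<^bsub>R\<^esub>, ring.add = ring.add R, smult = monoid.mult R\<rparr>"


section \<open>Complexes\<close>

definition cochain_complex ::
    "('a, 'x) ring_scheme \<Rightarrow> (int \<Rightarrow> ('a, 'm, 'y) module_scheme) \<Rightarrow> (int \<Rightarrow> 'm \<Rightarrow> 'm) \<Rightarrow> bool"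
  where "cochain_complex R C d \<longleftrightarrow>
    (\<forall>l. left_module R (C l) \<and> d l \<in> linear_maps (carrier R) (C l) (C (l + 1)) \<and>
      (\<forall>x\<in>carrier (C l). d (l + 1) (d l x) = \<zero>\<^bsub>C (l + 2)\<^esub>))"

definition acyclic_complex ::
    "('a, 'x) ring_scheme \<Rightarrow> (int \<Rightarrow> ('a, 'm, 'y) module_scheme) \<Rightarrow> (int \<Rightarrow> 'm \<Rightarrow> 'm) \<Rightarrow> bool"
  where "acyclic_complex R C d \<longleftrightarrow>
    cochain_complex R C d \<and>
    (\<forall>l. a_kernel (C (l + 1)) (C (l + 2)) (d (l + 1)) = d l ` carrier (C l))"


section \<open>Paths in a quiver\<close>

text \<open>A quiver is a \<^typ>\<open>('v, 'e) pre_digraph\<close> satisfying \<^locale>\<open>wf_digraph\<close> (parallel arrows and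
  loops are allowed), the arrow \<open>\<alpha>\<close> going from \<open>tail Q \<alpha>\<close> to \<open>head Q \<alpha>\<close>.
  The path \<open>\<alpha>\<^sub>m \<dots> \<alpha>\<^sub>1\<close>, composed from right to left, is represented by the pair of its starting
  vertex and the list \<open>[\<alpha>\<^sub>1, \<dots>, \<alpha>\<^sub>m]\<close>; the trivial path at \<open>i\<close> is \<open>(i, [])\<close>.\<close>

type_synonym ('v, 'e) path = "'v \<times> 'e list"

definition paths :: "('v, 'e) pre_digraph \<Rightarrow> ('v, 'e) path set"
  where "paths Q = {(u, w). \<exists>v. pre_digraph.awalk Q u w v}"

definition path_target :: "('v, 'e) pre_digraph \<Rightarrow> ('v, 'e) path \<Rightarrow> 'v"
  where "path_target Q p = pre_digraph.awlast Q (fst p) (snd p)"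

definition trivial_path :: "'v \<Rightarrow> ('v, 'e) path"
  where "trivial_path i = (i, [])"

definition arrow_path :: "('v, 'e) pre_digraph \<Rightarrow> 'e \<Rightarrow> ('v, 'e) path"
  where "arrow_path Q \<alpha> = (tail Q \<alpha>, [\<alpha>])"

text \<open>The path \<open>p q\<close>, running first through \<open>q\<close> and then through \<open>p\<close>; meaningful when \<open>p\<close> starts
  where \<open>q\<close> ends.\<close>

definition path_comp :: "('v, 'e) path \<Rightarrow> ('v, 'e) path \<Rightarrow> ('v, 'e) path"
  where "path_comp p q = (fst q, snd q @ snd p)"

text \<open>The path \<open>p\<close> with its last arrow \<open>\<alpha>\<^sub>m\<close> removed.\<close>

definition path_hat :: "('v, 'e) path \<Rightarrow> ('v, 'e) path"
  where "path_hat p = (fst p, butlast (snd p))"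


section \<open>The path algebra and its quotient with radical square zero\<close>

text \<open>The first argument of the following constants only records the field \<open>k\<close>.\<close>

definition path_algebra ::
    "'k::field itself \<Rightarrow> ('v, 'e) pre_digraph \<Rightarrow> (('v, 'e) path \<Rightarrow>\<^sub>0 'k) ring"
  where "path_algebra k Q =
    \<lparr>carrier = {f. Poly_Mapping.keys f \<subseteq> paths Q},
     monoid.mult = (\<lambda>f g. \<Sum>p\<in>Poly_Mapping.keys f. \<Sum>q\<in>Poly_Mapping.keys g.
       if fst p = path_target Q q
       then Poly_Mapping.single (path_comp p q) (Poly_Mapping.lookup f p * Poly_Mapping.lookup g q)
       else 0),
     one = (\<Sum>i\<in>verts Q. Poly_Mapping.single (trivial_path i) 1),
     ring.zero = 0, ring.add = (+)\<rparr>"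

definition arrow_ideal ::
    "'k::field itself \<Rightarrow> ('v, 'e) pre_digraph \<Rightarrow> (('v, 'e) path \<Rightarrow>\<^sub>0 'k) set"
  where "arrow_ideal k Q =
    genideal (path_algebra k Q) {Poly_Mapping.single (arrow_path Q \<alpha>) 1 | \<alpha>. \<alpha> \<in> arcs Q}"

definition arrow_ideal_sq ::
    "'k::field itself \<Rightarrow> ('v, 'e) pre_digraph \<Rightarrow> (('v, 'e) path \<Rightarrow>\<^sub>0 'k) set"
  where "arrow_ideal_sq k Q =
    ideal_prod (path_algebra k Q) (arrow_ideal k Q) (arrow_ideal k Q)"

definition rsz_algebra ::
    "'k::field itself \<Rightarrow> ('v, 'e) pre_digraph \<Rightarrow> (('v, 'e) path \<Rightarrow>\<^sub>0 'k) set ring"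
  where "rsz_algebra k Q = path_algebra k Q Quot arrow_ideal_sq k Q"

text \<open>The class of a path in \<open>A = kQ/J\<^sup>2\<close>, and the image \<open>c 1\<^sub>A\<close> of a scalar \<open>c\<close>.\<close>

definition path_class ::
    "'k::field itself \<Rightarrow> ('v, 'e) pre_digraph \<Rightarrow> ('v, 'e) path \<Rightarrow> (('v, 'e) path \<Rightarrow>\<^sub>0 'k) set"
  where "path_class k Q p = a_r_coset (path_algebra k Q) (arrow_ideal_sq k Q) (Poly_Mapping.single p 1)"

definition scalar_class ::
    "'k::field itself \<Rightarrow> ('v, 'e) pre_digraph \<Rightarrow> 'k \<Rightarrow> (('v, 'e) path \<Rightarrow>\<^sub>0 'k) set"
  where "scalar_class k Q c = a_r_coset (path_algebra k Q) (arrow_ideal_sq k Q)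
    (\<Sum>i\<in>verts Q. Poly_Mapping.single (trivial_path i) c)"

definition proj_module ::
    "'k::field itself \<Rightarrow> ('v, 'e) pre_digraph \<Rightarrow> 'v \<Rightarrow>
      ((('v, 'e) path \<Rightarrow>\<^sub>0 'k) set, (('v, 'e) path \<Rightarrow>\<^sub>0 'k) set) module"
  where "proj_module k Q i =
    principal_left_module (rsz_algebra k Q) (path_class k Q (trivial_path i))"


section \<open>The projective Leavitt complex\<close>

text \<open>\<open>assoc_arrow i\<close> is the associated arrow terminating at \<open>i\<close>; an arrow \<open>\<alpha>\<close> is thus associated iff
  \<open>\<alpha> = assoc_arrow (head Q \<alpha>)\<close>.\<close>

definition assoc_pairs ::
    "('v, 'e) pre_digraph \<Rightarrow> ('v \<Rightarrow> 'e) \<Rightarrow> (('v, 'e) path \<times> ('v, 'e) path) set"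
  where "assoc_pairs Q assoc_arrow =
    {(p, q). p \<in> paths Q \<and> q \<in> paths Q \<and> fst p = fst q \<and> snd p \<noteq> [] \<and> snd q \<noteq> [] \<and>
      (let \<alpha> = hd (snd p); \<beta> = hd (snd q) in \<alpha> \<noteq> \<beta> \<or> \<alpha> = \<beta> \<and> \<alpha> \<noteq> assoc_arrow (head Q \<alpha>))} \<union>
    {(p, trivial_path (fst p)) | p. p \<in> paths Q} \<union>
    {(trivial_path (fst p), p) | p. p \<in> paths Q}"

definition leavitt_index ::
    "('v, 'e) pre_digraph \<Rightarrow> ('v \<Rightarrow> 'e) \<Rightarrow> int \<Rightarrow> 'v \<Rightarrow> (('v, 'e) path \<times> ('v, 'e) path) set"
  where "leavitt_index Q assoc_arrow l i =
    {(p, q) \<in> assoc_pairs Q assoc_arrow.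
      int (length (snd q)) - int (length (snd p)) = l \<and> path_target Q p = i}"

type_synonym ('v, 'e, 'k) leavitt_elem =
  "'v \<Rightarrow> ('v, 'e) path \<times> ('v, 'e) path \<Rightarrow> (('v, 'e) path \<Rightarrow>\<^sub>0 'k) set"

definition leavitt_module ::
    "'k::field itself \<Rightarrow> ('v, 'e) pre_digraph \<Rightarrow> ('v \<Rightarrow> 'e) \<Rightarrow> int \<Rightarrow>
      ((('v, 'e) path \<Rightarrow>\<^sub>0 'k) set, ('v, 'e, 'k) leavitt_elem) module"
  where "leavitt_module k Q assoc_arrow l =
    direct_sum (verts Q) (\<lambda>i. direct_sum (leavitt_index Q assoc_arrow l i) (\<lambda>_. proj_module k Q i))"

text \<open>The element \<open>x \<zeta>\<^bsub>(p,q)\<^esub>\<close> in degree \<open>l\<close>, where \<open>x\<close> is (the class of) a path.\<close>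

definition zeta ::
    "'k::field itself \<Rightarrow> ('v, 'e) pre_digraph \<Rightarrow> ('v \<Rightarrow> 'e) \<Rightarrow> int \<Rightarrow>
      ('v, 'e) path \<Rightarrow> ('v, 'e) path \<times> ('v, 'e) path \<Rightarrow> ('v, 'e, 'k) leavitt_elem"
  where "zeta k Q assoc_arrow l x pq =
    (let i = path_target Q (fst pq) in
      direct_sum_inj (verts Q) (\<lambda>j. direct_sum (leavitt_index Q assoc_arrow l j) (\<lambda>_. proj_module k Q j)) i
        (direct_sum_inj (leavitt_index Q assoc_arrow l i) (\<lambda>_. proj_module k Q i) pq (path_class k Q x)))"

text \<open>The \<open>k\<close>-linear map with the prescribed values on the \<open>k\<close>-basis formed by the
  \<open>e\<^sub>i \<zeta>\<^bsub>(p,q)\<^esub>\<close> and the \<open>\<alpha> \<zeta>\<^bsub>(p,q)\<^esub>\<close> with \<open>\<alpha>\<close> starting at \<open>i\<close>; it is made unique as a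
  HOL function by being \<^const>\<open>undefined\<close> outside the module.\<close>

definition leavitt_differential ::
    "'k::field itself \<Rightarrow> ('v, 'e) pre_digraph \<Rightarrow> ('v \<Rightarrow> 'e) \<Rightarrow> int \<Rightarrow>
      ('v, 'e, 'k) leavitt_elem \<Rightarrow> ('v, 'e, 'k) leavitt_elem"
  where "leavitt_differential k Q assoc_arrow l =
    (THE f.
      f \<in> extensional (carrier (leavitt_module k Q assoc_arrow l)) \<and>
      f \<in> linear_maps (range (scalar_class k Q))
        (leavitt_module k Q assoc_arrow l) (leavitt_module k Q assoc_arrow (l + 1)) \<and>
      (\<forall>i\<in>verts Q. \<forall>(p, q)\<in>leavitt_index Q assoc_arrow l i.
        (\<forall>\<alpha>\<in>arcs Q. tail Q \<alpha> = i \<longrightarrow>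
          f (zeta k Q assoc_arrow l (arrow_path Q \<alpha>) (p, q)) = \<zero>\<^bsub>leavitt_module k Q assoc_arrow (l + 1)\<^esub>) \<and>
        f (zeta k Q assoc_arrow l (trivial_path i) (p, q)) =
          (if snd p = []
           then finsum (leavitt_module k Q assoc_arrow (l + 1))
             (\<lambda>\<beta>. zeta k Q assoc_arrow (l + 1) (arrow_path Q \<beta>)
               (trivial_path (tail Q \<beta>), path_comp q (arrow_path Q \<beta>)))
             {\<beta> \<in> arcs Q. head Q \<beta> = i}
           else zeta k Q assoc_arrow (l + 1) (arrow_path Q (last (snd p))) (path_hat p, q))))"

end

theory Submission
  imports Defs
begin

text \<open>Over the field \<open>k\<close>, degree \<open>l\<close> of the complex has a basis consisting of the symbols
  \<open>r \<zeta>\<^bsub>(p,q)\<^esub>\<close>, where \<open>(p,q)\<close> is an associated pair of degree \<open>l\<close> and \<open>r\<close> is either the trivial path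
  at the end of \<open>p\<close> or an arrow starting there. The differential kills all arrow symbols and takes the
  trivial symbols to combinations of arrow symbols, so its square is zero. It is exact because it maps
  the span of the trivial symbols isomorphically onto the span of the arrow symbols one degree higher:
  an arrow symbol \<open>\<beta> \<zeta>\<^bsub>(p,q)\<^esub>\<close> is the image of \<open>e \<zeta>\<^bsub>(\<beta>p,q)\<^esub>\<close> as long as \<open>(\<beta>p,q)\<close> is still associated.
  This only fails when \<open>p\<close> is trivial and \<open>q = q'\<beta>\<close> with \<open>\<beta>\<close> the associated arrow ending at its
  terminal vertex. There is exactly one such symbol for every \<open>q'\<close>, and it is the only one among the
  summands of the image of \<open>e \<zeta>\<^bsub>(e,q')\<^esub>\<close> that is not yet reached; hence the difference
  of \<open>e \<zeta>\<^bsub>(e,q')\<^esub>\<close> and the preimages of the other summands is a preimage of it. These choices of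
  preimages, extended by zero to the trivial symbols, form a contracting homotopy (\<open>h_basis\<close>,
  \<open>homotopy_basis\<close>), from which acyclicity follows.

  To carry out this computation one has to know that the symbols are indeed a \<open>k\<close>-basis. The square of
  the arrow ideal is the span of the paths of length at least two (\<open>arrow_ideal_sq_eq\<close>), so an element
  of \<open>A\<close> is determined by its coefficients at the paths of length at most one (\<open>cls_eq_iff\<close>). This
  identifies each module of the complex with a space of finitely supported functions, called chains
  below, by means of the bijection \<open>of_chain\<close> (\<open>of_chain_inj\<close>, \<open>of_chain_surj\<close>). On chains a linear
  map is the extension \<open>lin_ext\<close> of its values on basis elements. The differential, characterised by
  its values on the basis, is then the transport of such an extension (\<open>leavitt_differential_eq\<close>), and
  it is linear over all of \<open>A\<close> because it commutes with the action of every path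
  (\<open>D_path_act\<close>).\<close>

section \<open>Left modules\<close>

lemma (in left_module) smult_r_null:
  assumes "a \<in> carrier R"
  shows "a \<odot>\<^bsub>M\<^esub> \<zero>\<^bsub>M\<^esub> = \<zero>\<^bsub>M\<^esub>"
proof -
  have "a \<odot>\<^bsub>M\<^esub> \<zero>\<^bsub>M\<^esub> \<oplus>\<^bsub>M\<^esub> a \<odot>\<^bsub>M\<^esub> \<zero>\<^bsub>M\<^esub> = a \<odot>\<^bsub>M\<^esub> (\<zero>\<^bsub>M\<^esub> \<oplus>\<^bsub>M\<^esub> \<zero>\<^bsub>M\<^esub>)"
    using assms smult_r_distr[of a "\<zero>\<^bsub>M\<^esub>" "\<zero>\<^bsub>M\<^esub>"] by simp
  also have "\<dots> = a \<odot>\<^bsub>M\<^esub> \<zero>\<^bsub>M\<^esub> \<oplus>\<^bsub>M\<^esub> \<zero>\<^bsub>M\<^esub>" using assms smult_closed by simp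
  finally show ?thesis using assms smult_closed by simp
qed

lemma (in ring) left_module_principal:
  assumes e: "e \<in> carrier R"
  shows "left_module R (principal_left_module R e)"
proof -
  let ?M = "principal_left_module R e"
  have add: "a \<otimes> e \<oplus> b \<otimes> e \<in> carrier ?M" if "a \<in> carrier R" "b \<in> carrier R" for a b
    using that e l_distr[of a b e, symmetric] by (auto simp: principal_left_module_def)
  have sub: "carrier ?M \<subseteq> carrier R"
    using e by (auto simp: principal_left_module_def)
  have "abelian_group ?M"
  proof (rule abelian_groupI)
    fix x y assume "x \<in> carrier ?M" "y \<in> carrier ?M"
    then show "x \<oplus>\<^bsub>?M\<^esub> y \<in> carrier ?M" using add by (auto simp: principal_left_module_def)
  next
    show "\<zero>\<^bsub>?M\<^esub> \<in> carrier ?M"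
      using e l_null[of e] by (auto simp: principal_left_module_def intro!: exI[of _ "\<zero>"])
  next
    fix x assume "x \<in> carrier ?M"
    then obtain a where a: "a \<in> carrier R" "x = a \<otimes> e" by (auto simp: principal_left_module_def)
    have "(\<ominus> a) \<otimes> e \<oplus> x = \<zero>" using a e by (simp add: l_minus l_neg)
    then show "\<exists>y\<in>carrier ?M. y \<oplus>\<^bsub>?M\<^esub> x = \<zero>\<^bsub>?M\<^esub>"
      using a by (intro bexI[of _ "(\<ominus> a) \<otimes> e"]) (auto simp: principal_left_module_def)
  qed (use sub in \<open>auto simp: principal_left_module_def a_ac subset_iff e\<close>)
  moreover have "a \<otimes> x \<in> carrier ?M" if "a \<in> carrier R" "x \<in> carrier ?M" for a x
    using that e m_assoc[of a _ e, symmetric] by (auto simp: principal_left_module_def)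
  ultimately show ?thesis
    using sub
    by (auto intro!: left_module.intro left_module_axioms.intro ring_axioms
        simp: principal_left_module_def l_distr r_distr m_assoc e subset_iff)
qed

lemma left_module_direct_sum:
  assumes R: "ring R" and M: "\<And>i. i \<in> I \<Longrightarrow> left_module R (M i)"
  shows "left_module R (direct_sum I M)"
proof -
  let ?S = "direct_sum I M"
  have ab: "abelian_group (M i)" if "i \<in> I" for i
    using M[OF that] by (simp add: left_module_def)
  note closed = abelian_groupE(1)[OF ab]
  note zero = abelian_groupE(2)[OF ab]
  have "abelian_group ?S"
  proof (rule abelian_groupI)
    fix x y assume x: "x \<in> carrier ?S" and y: "y \<in> carrier ?S"
    have "{i \<in> I. x i \<oplus>\<^bsub>M i\<^esub> y i \<noteq> \<zero>\<^bsub>M i\<^esub>} \<subseteq>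
        {i \<in> I. x i \<noteq> \<zero>\<^bsub>M i\<^esub>} \<union> {i \<in> I. y i \<noteq> \<zero>\<^bsub>M i\<^esub>}"
      using abelian_groupE(5)[OF ab zero] by auto
    then have "finite {i \<in> I. x i \<oplus>\<^bsub>M i\<^esub> y i \<noteq> \<zero>\<^bsub>M i\<^esub>}"
      using x y by (auto simp: direct_sum_def elim: finite_subset)
    then show "x \<oplus>\<^bsub>?S\<^esub> y \<in> carrier ?S"
      using x y closed by (auto simp: direct_sum_def PiE_iff cong: conj_cong)
  next
    show "\<zero>\<^bsub>?S\<^esub> \<in> carrier ?S"
      using zero by (auto simp: direct_sum_def cong: conj_cong)
  next
    fix x y z assume "x \<in> carrier ?S" "y \<in> carrier ?S" "z \<in> carrier ?S"
    then show "x \<oplus>\<^bsub>?S\<^esub> y \<oplus>\<^bsub>?S\<^esub> z = x \<oplus>\<^bsub>?S\<^esub> (y \<oplus>\<^bsub>?S\<^esub> z)"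
      using abelian_groupE(3)[OF ab]
      by (auto simp: direct_sum_def PiE_iff fun_eq_iff)
  next
    fix x y assume "x \<in> carrier ?S" "y \<in> carrier ?S"
    then show "x \<oplus>\<^bsub>?S\<^esub> y = y \<oplus>\<^bsub>?S\<^esub> x"
      using abelian_groupE(4)[OF ab] by (auto simp: direct_sum_def PiE_iff fun_eq_iff)
  next
    fix x assume x: "x \<in> carrier ?S"
    then show "\<zero>\<^bsub>?S\<^esub> \<oplus>\<^bsub>?S\<^esub> x = x"
      using abelian_groupE(5)[OF ab] by (auto simp: direct_sum_def PiE_iff fun_eq_iff extensional_def)
    define y where "y = (\<lambda>i\<in>I. \<ominus>\<^bsub>M i\<^esub> x i)"
    have "\<ominus>\<^bsub>M i\<^esub> x i \<noteq> \<zero>\<^bsub>M i\<^esub> \<Longrightarrow> x i \<noteq> \<zero>\<^bsub>M i\<^esub>" if "i \<in> I" for i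
      using abelian_group.minus_equality[OF ab[OF that], of "\<zero>\<^bsub>M i\<^esub>" "\<zero>\<^bsub>M i\<^esub>"]
        abelian_groupE(5)[OF ab[OF that]] zero[OF that] by auto
    then have "{i \<in> I. y i \<noteq> \<zero>\<^bsub>M i\<^esub>} \<subseteq> {i \<in> I. x i \<noteq> \<zero>\<^bsub>M i\<^esub>}" by (auto simp: y_def)
    then have "finite {i \<in> I. y i \<noteq> \<zero>\<^bsub>M i\<^esub>}"
      using x by (auto simp: direct_sum_def elim: finite_subset)
    then have "y \<in> carrier ?S"
      using x abelian_group.a_inv_closed[OF ab] by (auto simp: direct_sum_def y_def PiE_iff)
    moreover have "y \<oplus>\<^bsub>?S\<^esub> x = \<zero>\<^bsub>?S\<^esub>"
      using x abelian_group.l_neg[OF ab] by (auto simp: direct_sum_def y_def PiE_iff fun_eq_iff)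
    ultimately show "\<exists>y\<in>carrier ?S. y \<oplus>\<^bsub>?S\<^esub> x = \<zero>\<^bsub>?S\<^esub>" by blast
  qed
  moreover have "left_module_axioms R ?S"
  proof
    fix a x assume a: "a \<in> carrier R" and x: "x \<in> carrier ?S"
    have "{i \<in> I. a \<odot>\<^bsub>M i\<^esub> x i \<noteq> \<zero>\<^bsub>M i\<^esub>} \<subseteq> {i \<in> I. x i \<noteq> \<zero>\<^bsub>M i\<^esub>}"
      using left_module.smult_r_null[OF M a] by auto
    then have "finite {i \<in> I. a \<odot>\<^bsub>M i\<^esub> x i \<noteq> \<zero>\<^bsub>M i\<^esub>}"
      using x by (auto simp: direct_sum_def elim: finite_subset)
    then show "a \<odot>\<^bsub>?S\<^esub> x \<in> carrier ?S"
      using a x left_module.smult_closed[OF M]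
      by (auto simp: direct_sum_def PiE_iff cong: conj_cong)
  qed (auto simp: direct_sum_def PiE_iff fun_eq_iff extensional_def left_module.smult_l_distr[OF M]
      left_module.smult_r_distr[OF M] left_module.smult_assoc1[OF M] left_module.smult_one[OF M])
  ultimately show ?thesis using R by (simp add: left_module_def)
qed

lemma linear_maps_antimono: "S \<subseteq> T \<Longrightarrow> linear_maps T N N' \<subseteq> linear_maps S N N'"
  unfolding linear_maps_def by blast

section \<open>Linear extension\<close>

abbreviation scale :: "'k::field \<Rightarrow> ('b \<Rightarrow>\<^sub>0 'k) \<Rightarrow> ('b \<Rightarrow>\<^sub>0 'k)"
  where "scale a \<equiv> Poly_Mapping.map ((*) a)"

lemma lookup_scale [simp]: "Poly_Mapping.lookup (scale a c) b = a * Poly_Mapping.lookup c b"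
  by (simp add: Poly_Mapping.map.rep_eq when_def)

lemma scale_add: "scale a (c + d) = scale a c + scale a d"
  and scale_add_left: "scale (a + b) c = scale a c + scale b c"
  and scale_scale: "scale a (scale b c) = scale (a * b) c"
  and scale_zero [simp]: "scale a 0 = 0"
  and scale_zero_left [simp]: "scale 0 c = 0"
  and scale_one [simp]: "scale 1 c = c"
  and scale_single [simp]: "scale a (Poly_Mapping.single x b) = Poly_Mapping.single x (a * b)"
  by (auto intro!: poly_mapping_eqI simp: lookup_add lookup_single when_def algebra_simps)

lemma scale_sum: "scale a (sum f S) = (\<Sum>x\<in>S. scale a (f x))"
  by (induction S rule: infinite_finite_induct) (auto simp: scale_add)

definition lin_ext :: "('b \<Rightarrow> 'c \<Rightarrow>\<^sub>0 'k) \<Rightarrow> ('b \<Rightarrow>\<^sub>0 'k) \<Rightarrow> ('c \<Rightarrow>\<^sub>0 'k::field)"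
  where "lin_ext \<phi> c = (\<Sum>b\<in>Poly_Mapping.keys c. scale (Poly_Mapping.lookup c b) (\<phi> b))"

lemma lin_ext_superset:
  assumes "finite S" "Poly_Mapping.keys c \<subseteq> S"
  shows "lin_ext \<phi> c = (\<Sum>b\<in>S. scale (Poly_Mapping.lookup c b) (\<phi> b))"
  unfolding lin_ext_def using assms
  by (intro sum.mono_neutral_left) (auto simp: in_keys_iff)

lemma lin_ext_zero [simp]: "lin_ext \<phi> 0 = 0"
  by (simp add: lin_ext_def)

lemma lin_ext_single [simp]: "lin_ext \<phi> (Poly_Mapping.single b a) = scale a (\<phi> b)"
  by (subst lin_ext_superset[of "{b}"]) auto

lemma lin_ext_add: "lin_ext \<phi> (c + d) = lin_ext \<phi> c + lin_ext \<phi> d"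
proof -
  let ?S = "Poly_Mapping.keys c \<union> Poly_Mapping.keys d"
  have "Poly_Mapping.keys (c + d) \<subseteq> ?S" by (rule keys_add)
  then show ?thesis
    by (simp add: lin_ext_superset[of ?S] lookup_add scale_add_left sum.distrib)
qed

lemma lin_ext_sum: "lin_ext \<phi> (sum f S) = (\<Sum>x\<in>S. lin_ext \<phi> (f x))"
  by (induction S rule: infinite_finite_induct) (auto simp: lin_ext_add)

lemma lin_ext_scale: "lin_ext \<phi> (scale a c) = scale a (lin_ext \<phi> c)"
proof -
  have "Poly_Mapping.keys (scale a c) \<subseteq> Poly_Mapping.keys c" by (auto simp: in_keys_iff)
  then show ?thesis
    by (simp add: lin_ext_superset[of "Poly_Mapping.keys c"] scale_sum scale_scale)
qed

lemma lin_ext_lin_ext: "lin_ext \<phi> (lin_ext \<psi> c) = lin_ext (\<lambda>b. lin_ext \<phi> (\<psi> b)) c"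
  by (simp add: lin_ext_def[of \<psi>] lin_ext_def[of "\<lambda>b. lin_ext \<phi> (\<psi> b)"] lin_ext_sum lin_ext_scale)

lemma lin_ext_plus_fun: "lin_ext \<phi> c + lin_ext \<psi> c = lin_ext (\<lambda>b. \<phi> b + \<psi> b) c"
  by (simp add: lin_ext_def scale_add sum.distrib)

lemma lin_ext_cong:
  "(\<And>b. b \<in> Poly_Mapping.keys c \<Longrightarrow> \<phi> b = \<psi> b) \<Longrightarrow> lin_ext \<phi> c = lin_ext \<psi> c"
  by (simp add: lin_ext_def)

lemma lin_ext_zero_fun: "lin_ext (\<lambda>b. 0) c = 0"
  by (simp add: lin_ext_def)

lemma lin_ext_id: "lin_ext (\<lambda>b. Poly_Mapping.single b 1) c = c"
proof (rule poly_mapping_eqI)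
  fix x
  show "Poly_Mapping.lookup (lin_ext (\<lambda>b. Poly_Mapping.single b 1) c) x = Poly_Mapping.lookup c x"
    by (simp add: lin_ext_def lookup_sum lookup_single when_def in_keys_iff)
qed

lemma keys_sum_subset:
  assumes "\<And>x. x \<in> S \<Longrightarrow> Poly_Mapping.keys (f x) \<subseteq> T"
  shows "Poly_Mapping.keys (sum f S) \<subseteq> T"
  using assms by (induction S rule: infinite_finite_induct) (auto dest!: subsetD[OF keys_add])

lemma keys_lin_ext:
  assumes "\<And>b. b \<in> Poly_Mapping.keys c \<Longrightarrow> Poly_Mapping.keys (\<phi> b) \<subseteq> T"
  shows "Poly_Mapping.keys (lin_ext \<phi> c) \<subseteq> T"
  unfolding lin_ext_def
proof (rule keys_sum_subset)
  fix b assume "b \<in> Poly_Mapping.keys c"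
  then show "Poly_Mapping.keys (scale (Poly_Mapping.lookup c b) (\<phi> b)) \<subseteq> T"
    using assms[of b] by (auto simp: in_keys_iff)
qed

text \<open>To verify that two additive maps agree, or that an additively closed property holds, it is enough to
  look at multiples of basis elements; the bound \<open>B\<close> on the support is kept through the induction so
  that facts about the basis of a fixed degree remain applicable.\<close>

lemma additive_induct [consumes 1, case_names zero single add]:
  assumes "Poly_Mapping.keys c \<subseteq> B" and "P 0"
    and "\<And>b a. b \<in> B \<Longrightarrow> P (Poly_Mapping.single b a)"
    and "\<And>c d. P c \<Longrightarrow> P d \<Longrightarrow> Poly_Mapping.keys c \<subseteq> B \<Longrightarrow> Poly_Mapping.keys d \<subseteq> B \<Longrightarrow> P (c + d)"
  shows "P (c :: 'b \<Rightarrow>\<^sub>0 'k::field)"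
proof -
  have "P (\<Sum>b\<in>S. Poly_Mapping.single b (Poly_Mapping.lookup c b)) \<and>
      Poly_Mapping.keys (\<Sum>b\<in>S. Poly_Mapping.single b (Poly_Mapping.lookup c b)) \<subseteq> B"
    if "finite S" "S \<subseteq> B" for S
    using that
  proof (induction S rule: finite_induct)
    case empty then show ?case using assms(2) by simp
  next
    case (insert b S)
    moreover have "Poly_Mapping.keys (Poly_Mapping.single b (Poly_Mapping.lookup c b)) \<subseteq> B"
      using insert by auto
    ultimately show ?case
      using assms(3,4) keys_add by (auto dest!: subsetD[OF keys_add])
  qed
  from this[of "Poly_Mapping.keys c"] assms(1)
  have "P (lin_ext (\<lambda>b. Poly_Mapping.single b 1) c)" by (simp add: lin_ext_def)
  then show ?thesis by (simp add: lin_ext_id)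
qed

section \<open>The path algebra\<close>

lemma path_target_simp: "path_target Q (u, w) = (if w = [] then u else head Q (last w))"
  by (simp add: path_target_def pre_digraph.awalk_verts_conv)

lemma path_target_append:
  "path_target Q (u, w @ w') = path_target Q (path_target Q (u, w), w')"
  by (simp add: path_target_simp)

context wf_digraph
begin

lemma Nil_mem_paths [simp]: "(u, []) \<in> paths G \<longleftrightarrow> u \<in> verts G"
  by (auto simp: paths_def awalk_Nil_iff)

lemma Cons_mem_paths [simp]:
  "(u, e # w) \<in> paths G \<longleftrightarrow> e \<in> arcs G \<and> u = tail G e \<and> (head G e, w) \<in> paths G"
  by (auto simp: paths_def awalk_Cons_iff)

lemma arrow_path_mem_paths: "\<alpha> \<in> arcs G \<Longrightarrow> arrow_path G \<alpha> \<in> paths G"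
  by (simp add: arrow_path_def)

lemma append_mem_paths:
  "(u, w @ w') \<in> paths G \<longleftrightarrow> (u, w) \<in> paths G \<and> (path_target G (u, w), w') \<in> paths G"
  by (auto simp: paths_def path_target_def)

lemma path_target_in_verts: "p \<in> paths G \<Longrightarrow> path_target G p \<in> verts G"
  by (auto simp: paths_def path_target_def)

lemma path_source_in_verts: "p \<in> paths G \<Longrightarrow> fst p \<in> verts G"
  by (auto simp: paths_def)

lemma path_comp_mem_paths:
  "p \<in> paths G \<Longrightarrow> q \<in> paths G \<Longrightarrow> fst p = path_target G q \<Longrightarrow> path_comp p q \<in> paths G"
  by (cases p; cases q) (auto simp: path_comp_def append_mem_paths)

end

locale quiver = fin_digraph Q for Q :: "('v, 'e) pre_digraph" +
  fixes k :: "'k::field itself"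
begin

abbreviation kQ :: "(('v, 'e) path \<Rightarrow>\<^sub>0 'k) ring"
  where "kQ \<equiv> path_algebra k Q"

lemma kQ_simps [simp]:
  "carrier kQ = {f. Poly_Mapping.keys f \<subseteq> paths Q}"
  "\<zero>\<^bsub>kQ\<^esub> = 0" "f \<oplus>\<^bsub>kQ\<^esub> g = f + g"
  by (simp_all add: path_algebra_def)

text \<open>A path is a product of two paths once for every position at which it can be cut. The formula does not
  ask \<open>(u, w)\<close> to be a path, so the bilinear laws and associativity hold for all finitely
  supported functions.\<close>

lemma lookup_mult_kQ:
  "Poly_Mapping.lookup (f \<otimes>\<^bsub>kQ\<^esub> g) (u, w) =
    (\<Sum>n\<le>length w. Poly_Mapping.lookup f (path_target Q (u, take n w), drop n w) *
      Poly_Mapping.lookup g (u, take n w))"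
proof -
  define C where "C = {(p, q) \<in> Poly_Mapping.keys f \<times> Poly_Mapping.keys g.
    fst p = path_target Q q \<and> path_comp p q = (u, w)}"
  define N where "N = {n \<in> {..length w}.
    (path_target Q (u, take n w), drop n w) \<in> Poly_Mapping.keys f \<and> (u, take n w) \<in> Poly_Mapping.keys g}"
  have "Poly_Mapping.lookup (f \<otimes>\<^bsub>kQ\<^esub> g) (u, w) =
    (\<Sum>(p, q)\<in>Poly_Mapping.keys f \<times> Poly_Mapping.keys g.
      if fst p = path_target Q q \<and> path_comp p q = (u, w)
      then Poly_Mapping.lookup f p * Poly_Mapping.lookup g q else 0)"
    unfolding sum.cartesian_product[symmetric]
    by (auto simp: path_algebra_def lookup_sum lookup_single intro!: sum.cong)
  also have "\<dots> = (\<Sum>(p, q)\<in>C. Poly_Mapping.lookup f p * Poly_Mapping.lookup g q)"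
    by (rule sum.mono_neutral_cong_right) (auto simp: C_def split: if_splits)
  also have "\<dots> = (\<Sum>n\<in>N. Poly_Mapping.lookup f (path_target Q (u, take n w), drop n w) *
      Poly_Mapping.lookup g (u, take n w))"
    by (rule sum.reindex_bij_witness[where
          j = "\<lambda>(p, q). length (snd q)" and
          i = "\<lambda>n. ((path_target Q (u, take n w), drop n w), (u, take n w))"])
      (auto simp: C_def N_def path_comp_def)
  also have "\<dots> = (\<Sum>n\<le>length w. Poly_Mapping.lookup f (path_target Q (u, take n w), drop n w) *
      Poly_Mapping.lookup g (u, take n w))"
    by (rule sum.mono_neutral_left) (auto simp: N_def in_keys_iff)
  finally show ?thesis .
qed

lemma mult_add_left_kQ: "(f + g) \<otimes>\<^bsub>kQ\<^esub> h = f \<otimes>\<^bsub>kQ\<^esub> h + g \<otimes>\<^bsub>kQ\<^esub> h"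
  and mult_add_right_kQ: "h \<otimes>\<^bsub>kQ\<^esub> (f + g) = h \<otimes>\<^bsub>kQ\<^esub> f + h \<otimes>\<^bsub>kQ\<^esub> g"
  by (auto intro!: poly_mapping_eqI simp: lookup_mult_kQ lookup_add ring_distribs sum.distrib)

lemma mult_zero_right_kQ [simp]: "f \<otimes>\<^bsub>kQ\<^esub> 0 = 0"
  by (simp add: path_algebra_def)

lemma keys_mult_kQ:
  assumes "p \<in> Poly_Mapping.keys (f \<otimes>\<^bsub>kQ\<^esub> g)"
  obtains q r where "q \<in> Poly_Mapping.keys f" "r \<in> Poly_Mapping.keys g"
    "fst q = path_target Q r" "p = path_comp q r"
proof -
  obtain u w where p: "p = (u, w)" by (cases p)
  have "(\<Sum>n\<le>length w. Poly_Mapping.lookup f (path_target Q (u, take n w), drop n w) *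
      Poly_Mapping.lookup g (u, take n w)) \<noteq> 0"
    using assms by (simp add: p in_keys_iff lookup_mult_kQ)
  then obtain n where "Poly_Mapping.lookup f (path_target Q (u, take n w), drop n w) *
      Poly_Mapping.lookup g (u, take n w) \<noteq> 0"
    by (meson sum.not_neutral_contains_not_neutral)
  then show ?thesis
    by (intro that[of "(path_target Q (u, take n w), drop n w)" "(u, take n w)"])
      (auto simp: in_keys_iff path_comp_def p)
qed

lemma mult_single_kQ:
  "Poly_Mapping.single p a \<otimes>\<^bsub>kQ\<^esub> Poly_Mapping.single q b =
    (if fst p = path_target Q q then Poly_Mapping.single (path_comp p q) (a * b) else 0)"
  by (simp add: path_algebra_def)

lemma mult_closed_kQ:
  "f \<in> carrier kQ \<Longrightarrow> g \<in> carrier kQ \<Longrightarrow> f \<otimes>\<^bsub>kQ\<^esub> g \<in> carrier kQ"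
  by (auto elim!: keys_mult_kQ intro!: path_comp_mem_paths)

lemma lookup_idempotents:
  "Poly_Mapping.lookup (\<Sum>i\<in>verts Q. Poly_Mapping.single (trivial_path i) a) (u, w) =
    (if w = [] \<and> u \<in> verts Q then a else 0)"
proof -
  have "Poly_Mapping.lookup (\<Sum>i\<in>verts Q. Poly_Mapping.single (trivial_path i) a) (u, w) =
      (\<Sum>i\<in>verts Q. if i = u then (if w = [] then a else 0) else 0)"
    by (auto simp: lookup_sum lookup_single when_def trivial_path_def intro!: sum.cong)
  then show ?thesis by simp
qed

lemma lookup_kQ_eq_0: "f \<in> carrier kQ \<Longrightarrow> p \<notin> paths Q \<Longrightarrow> Poly_Mapping.lookup f p = 0"
  by (cases p) (auto simp: in_keys_iff)

text \<open>The sum over the vertices acts on the left as multiplication by the scalar \<open>a\<close>, since every path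
  ends at exactly one vertex; for \<open>a = 1\<close> this is the left unit law.\<close>

lemma lookup_mult_scalar:
  assumes "g \<in> carrier kQ"
  shows "Poly_Mapping.lookup ((\<Sum>i\<in>verts Q. Poly_Mapping.single (trivial_path i) a) \<otimes>\<^bsub>kQ\<^esub> g) p =
    a * Poly_Mapping.lookup g p"
proof -
  obtain u w where p: "p = (u, w)" by (cases p)
  have "Poly_Mapping.lookup ((\<Sum>i\<in>verts Q. Poly_Mapping.single (trivial_path i) a) \<otimes>\<^bsub>kQ\<^esub> g) p =
    (\<Sum>n\<le>length w. if n = length w then (if path_target Q p \<in> verts Q then a else 0) *
      Poly_Mapping.lookup g p else 0)"
    unfolding p lookup_mult_kQ lookup_idempotents by (intro sum.cong) auto
  also have "\<dots> = (if path_target Q p \<in> verts Q then a else 0) * Poly_Mapping.lookup g p"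
    by simp
  also have "\<dots> = a * Poly_Mapping.lookup g p"
    using lookup_kQ_eq_0[OF assms, of p] path_target_in_verts[of p] by auto
  finally show ?thesis .
qed

lemma idempotents_closed: "(\<Sum>i\<in>verts Q. Poly_Mapping.single (trivial_path i) a) \<in> carrier kQ"
  unfolding kQ_simps mem_Collect_eq by (rule keys_sum_subset) (auto simp: trivial_path_def)

lemma ring_kQ: "ring kQ"
proof (rule ringI)
  show "abelian_group kQ"
  proof (rule abelian_groupI)
    fix x assume "x \<in> carrier kQ"
    then show "\<exists>y\<in>carrier kQ. y \<oplus>\<^bsub>kQ\<^esub> x = \<zero>\<^bsub>kQ\<^esub>"
      by (intro bexI[of _ "- x"]) auto
  qed (auto simp: add_ac dest!: subsetD[OF keys_add])
next
  have one: "\<one>\<^bsub>kQ\<^esub> = (\<Sum>i\<in>verts Q. Poly_Mapping.single (trivial_path i) 1)"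
    by (simp add: path_algebra_def)
  show "Group.monoid kQ"
  proof (rule monoidI)
    fix f g h :: "('v, 'e) path \<Rightarrow>\<^sub>0 'k"
    let ?f = "Poly_Mapping.lookup f" and ?g = "Poly_Mapping.lookup g" and ?h = "Poly_Mapping.lookup h"
    show "f \<otimes>\<^bsub>kQ\<^esub> g \<otimes>\<^bsub>kQ\<^esub> h = f \<otimes>\<^bsub>kQ\<^esub> (g \<otimes>\<^bsub>kQ\<^esub> h)"
    proof (rule poly_mapping_eqI)
      fix p :: "('v, 'e) path"
      obtain u w where p: "p = (u, w)" by (cases p)
      let ?t = "\<lambda>n. path_target Q (u, take n w)"
      have t: "path_target Q (?t n, take m (drop n w)) = ?t (n + m)" for n m
        by (simp add: path_target_append[symmetric] take_add)
      have "Poly_Mapping.lookup (f \<otimes>\<^bsub>kQ\<^esub> g \<otimes>\<^bsub>kQ\<^esub> h) p =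
        (\<Sum>n\<le>length w. \<Sum>m\<le>length w - n. ?f (?t (n + m), drop (n + m) w) *
          ?g (?t n, take m (drop n w)) * ?h (u, take n w))"
        by (simp add: p lookup_mult_kQ t sum_distrib_right add.commute)
      \<comment> \<open>Both sides sum over the ways to cut \<open>w\<close> twice, at \<open>n \<le> n + m\<close> on the left.\<close>
      also have "\<dots> = (\<Sum>n\<le>length w. \<Sum>m\<le>n. ?f (?t n, drop n w) *
          (?g (?t m, drop m (take n w)) * ?h (u, take m w)))"
        unfolding sum.Sigma[OF finite_atMost ballI[OF finite_atMost]]
        by (rule sum.reindex_bij_witness[where j = "\<lambda>(n, m). (n + m, n)" and i = "\<lambda>(n, m). (m, n - m)"])
          (auto simp: drop_take mult.assoc)
      also have "\<dots> = Poly_Mapping.lookup (f \<otimes>\<^bsub>kQ\<^esub> (g \<otimes>\<^bsub>kQ\<^esub> h)) p"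
      proof -
        have "Poly_Mapping.lookup (g \<otimes>\<^bsub>kQ\<^esub> h) (u, take n w) =
            (\<Sum>m\<le>n. ?g (?t m, drop m (take n w)) * ?h (u, take m w))" if "n \<le> length w" for n
          unfolding lookup_mult_kQ using that by (intro sum.cong) (auto simp: min_absorb1 min_absorb2)
        then show ?thesis
          unfolding p lookup_mult_kQ[of f] by (intro sum.cong) (auto simp: sum_distrib_left)
      qed
      finally show "Poly_Mapping.lookup (f \<otimes>\<^bsub>kQ\<^esub> g \<otimes>\<^bsub>kQ\<^esub> h) p =
        Poly_Mapping.lookup (f \<otimes>\<^bsub>kQ\<^esub> (g \<otimes>\<^bsub>kQ\<^esub> h)) p" .
    qed
  next
    show "\<one>\<^bsub>kQ\<^esub> \<in> carrier kQ"
      unfolding one by (rule idempotents_closed)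
  next
    fix f assume f: "f \<in> carrier kQ"
    show "\<one>\<^bsub>kQ\<^esub> \<otimes>\<^bsub>kQ\<^esub> f = f"
      using f unfolding one by (intro poly_mapping_eqI) (subst lookup_mult_scalar, auto)
    show "f \<otimes>\<^bsub>kQ\<^esub> \<one>\<^bsub>kQ\<^esub> = f"
    proof (rule poly_mapping_eqI)
      fix p :: "('v, 'e) path"
      obtain u w where p: "p = (u, w)" by (cases p)
      have "Poly_Mapping.lookup (f \<otimes>\<^bsub>kQ\<^esub> \<one>\<^bsub>kQ\<^esub>) p =
        (\<Sum>n\<le>length w. if n = 0 then Poly_Mapping.lookup f p * (if u \<in> verts Q then 1 else 0) else 0)"
        unfolding p lookup_mult_kQ one lookup_idempotents
        by (intro sum.cong) (auto simp: path_target_simp)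
      also have "\<dots> = Poly_Mapping.lookup f p"
        using lookup_kQ_eq_0[OF f, of p] path_source_in_verts[of p] by (auto simp: p)
      finally show "Poly_Mapping.lookup (f \<otimes>\<^bsub>kQ\<^esub> \<one>\<^bsub>kQ\<^esub>) p = Poly_Mapping.lookup f p" .
    qed
  qed (rule mult_closed_kQ)
next
qed (simp_all add: mult_add_left_kQ mult_add_right_kQ)

section \<open>The square of the arrow ideal\<close>

text \<open>For positive \<open>n\<close> this is the \<open>n\<close>-th power of the arrow ideal, described by supports.\<close>

definition length_filtration :: "nat \<Rightarrow> (('v, 'e) path \<Rightarrow>\<^sub>0 'k) set"
  where "length_filtration n = {f. Poly_Mapping.keys f \<subseteq> {p \<in> paths Q. n \<le> length (snd p)}}"

lemma mult_length_filtration: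
  assumes "f \<in> length_filtration m" "g \<in> length_filtration n"
  shows "f \<otimes>\<^bsub>kQ\<^esub> g \<in> length_filtration (m + n)"
  unfolding length_filtration_def
proof (intro CollectI subsetI)
  fix p assume "p \<in> Poly_Mapping.keys (f \<otimes>\<^bsub>kQ\<^esub> g)"
  then obtain q r where qr: "q \<in> Poly_Mapping.keys f" "r \<in> Poly_Mapping.keys g"
    "fst q = path_target Q r" "p = path_comp q r"
    by (rule keys_mult_kQ)
  then have "q \<in> paths Q" "r \<in> paths Q" "m \<le> length (snd q)" "n \<le> length (snd r)"
    using assms by (auto simp: length_filtration_def)
  then show "p \<in> paths Q \<and> m + n \<le> length (snd p)"
    using qr path_comp_mem_paths[of q r] by (simp add: path_comp_def)
qed

lemma carrier_length_filtration: "carrier kQ = length_filtration 0"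
  by (auto simp: length_filtration_def)

lemma ideal_length_filtration: "ideal (length_filtration n) kQ"
proof (rule idealI[OF ring_kQ])
  interpret ring kQ by (rule ring_kQ)
  show "subgroup (length_filtration n) (add_monoid kQ)"
  proof (rule add.subgroupI)
    fix f assume f: "f \<in> length_filtration n"
    then have "\<ominus>\<^bsub>kQ\<^esub> f = - f"
      by (intro minus_equality) (auto simp: length_filtration_def)
    then show "\<ominus>\<^bsub>kQ\<^esub> f \<in> length_filtration n"
      using f by (simp add: length_filtration_def)
  qed (auto simp: length_filtration_def dest!: subsetD[OF keys_add] intro!: exI[of _ 0])
next
  fix f g assume "f \<in> length_filtration n" "g \<in> carrier kQ"
  then show "g \<otimes>\<^bsub>kQ\<^esub> f \<in> length_filtration n" "f \<otimes>\<^bsub>kQ\<^esub> g \<in> length_filtration n"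
    using mult_length_filtration[of f n g 0] mult_length_filtration[of g 0 f n]
    by (simp_all only: carrier_length_filtration add_0_left add_0_right)
qed

text \<open>The first arrow of a path splits off as a right factor. Applied once it puts every path of positive
  length into the ideal generated by the arrows, and applied to a path of length at least two it
  exhibits the path as a product of two elements of that ideal.\<close>

lemma single_Cons_factor:
  assumes "(u, e # w) \<in> paths Q"
  shows "Poly_Mapping.single (u, e # w) a =
    Poly_Mapping.single (head Q e, w) a \<otimes>\<^bsub>kQ\<^esub> Poly_Mapping.single (arrow_path Q e) 1"
  using assms by (simp add: mult_single_kQ path_target_simp arrow_path_def path_comp_def)

lemma arrow_ideal_eq: "arrow_ideal k Q = length_filtration 1"
proof
  have arrows: "{Poly_Mapping.single (arrow_path Q \<alpha>) (1 :: 'k) | \<alpha>. \<alpha> \<in> arcs Q} \<subseteq> length_filtration 1"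
    using arrow_path_mem_paths by (auto simp: length_filtration_def arrow_path_def)
  then show "arrow_ideal k Q \<subseteq> length_filtration 1"
    unfolding arrow_ideal_def
    by (rule ring.genideal_minimal[OF ring_kQ ideal_length_filtration])
  have arrows': "{Poly_Mapping.single (arrow_path Q \<alpha>) (1 :: 'k) | \<alpha>. \<alpha> \<in> arcs Q} \<subseteq> carrier kQ"
    using arrow_path_mem_paths by auto
  interpret I: ideal "arrow_ideal k Q" kQ
    unfolding arrow_ideal_def by (rule ring.genideal_ideal[OF ring_kQ arrows'])
  show "length_filtration 1 \<subseteq> arrow_ideal k Q"
  proof
    fix f :: "('v, 'e) path \<Rightarrow>\<^sub>0 'k" assume "f \<in> length_filtration 1"
    then have "Poly_Mapping.keys f \<subseteq> {p \<in> paths Q. 1 \<le> length (snd p)}"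
      by (simp add: length_filtration_def)
    then show "f \<in> arrow_ideal k Q"
    proof (induction rule: additive_induct)
      case zero
      show ?case using additive_subgroup.zero_closed[OF I.is_additive_subgroup] by simp
    next
      case (single p a)
      then obtain u e w where p: "p = (u, e # w)" "(u, e # w) \<in> paths Q"
        by (cases p; cases "snd p") auto
      have "Poly_Mapping.single (arrow_path Q e) (1 :: 'k) \<in> arrow_ideal k Q"
        unfolding arrow_ideal_def using p
        by (intro subsetD[OF ring.genideal_self[OF ring_kQ arrows']]) auto
      then show ?case
        unfolding p(1) single_Cons_factor[OF p(2)] using p(2) by (intro I.I_l_closed) auto
    next
      case (add c d)
      then show ?case using additive_subgroup.a_closed[OF I.is_additive_subgroup, of c d] by simp
    qed
  qed
qed

lemma arrow_ideal_sq_eq: "arrow_ideal_sq k Q = length_filtration 2"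
proof
  show "arrow_ideal_sq k Q \<subseteq> length_filtration 2"
    unfolding arrow_ideal_sq_def arrow_ideal_eq
  proof
    fix f assume "f \<in> ideal_prod kQ (length_filtration 1) (length_filtration 1)"
    then show "f \<in> length_filtration 2"
    proof induction
      case (prod i j)
      then show ?case using mult_length_filtration[of i 1 j 1] by (simp add: numeral_2_eq_2)
    next
      case (sum s1 s2)
      then show ?case
        using additive_subgroup.a_closed[OF ideal.axioms(1)[OF ideal_length_filtration]] by blast
    qed
  qed
  show "length_filtration 2 \<subseteq> arrow_ideal_sq k Q"
    unfolding arrow_ideal_sq_def arrow_ideal_eq
  proof
    let ?JJ = "ideal_prod kQ (length_filtration 1) (length_filtration 1)"
    fix f :: "('v, 'e) path \<Rightarrow>\<^sub>0 'k" assume "f \<in> length_filtration 2"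
    then have "Poly_Mapping.keys f \<subseteq> {p \<in> paths Q. 2 \<le> length (snd p)}"
      by (simp add: length_filtration_def)
    then show "f \<in> ?JJ"
    proof (induction rule: additive_induct)
      case zero
      \<comment> \<open>The ideal product is generated by products and sums alone, so zero has to be a product.\<close>
      have "0 \<otimes>\<^bsub>kQ\<^esub> 0 \<in> ?JJ"
        by (rule ideal_prod.prod) (auto simp: length_filtration_def)
      then show ?case by simp
    next
      case (single p a)
      then obtain u e e' w where p: "p = (u, e # e' # w)" "(u, e # e' # w) \<in> paths Q"
        by (cases p; cases "snd p"; cases "tl (snd p)") auto
      show ?case
        unfolding p(1) single_Cons_factor[OF p(2)] using p(2)
        by (intro ideal_prod.prod) (auto simp: length_filtration_def arrow_path_def)
    next
      case (add c d)
      then show ?case using ideal_prod.sum[of c kQ] by simp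
    qed
  qed
qed


section \<open>The algebra with radical square zero\<close>

abbreviation A :: "(('v, 'e) path \<Rightarrow>\<^sub>0 'k) set ring"
  where "A \<equiv> rsz_algebra k Q"

definition cls :: "(('v, 'e) path \<Rightarrow>\<^sub>0 'k) \<Rightarrow> (('v, 'e) path \<Rightarrow>\<^sub>0 'k) set"
  where "cls f = a_r_coset kQ (arrow_ideal_sq k Q) f"

lemma ideal_arrow_ideal_sq: "ideal (arrow_ideal_sq k Q) kQ"
  unfolding arrow_ideal_sq_eq by (rule ideal_length_filtration)

lemma ring_A: "ring A"
  unfolding rsz_algebra_def by (rule ideal.quotient_is_ring[OF ideal_arrow_ideal_sq])

lemma cls_ring_hom: "cls \<in> ring_hom kQ A"
  using ideal.rcos_ring_hom[OF ideal_arrow_ideal_sq]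
  by (simp add: rsz_algebra_def cls_def[abs_def])

lemma carrier_A: "carrier A = cls ` carrier kQ"
  unfolding rsz_algebra_def FactRing_def A_RCOSETS_def'
  by (auto simp: cls_def simp del: kQ_simps)

lemma cls_closed: "f \<in> carrier kQ \<Longrightarrow> cls f \<in> carrier A"
  by (auto simp: carrier_A)

lemma cls_add: "f \<in> carrier kQ \<Longrightarrow> g \<in> carrier kQ \<Longrightarrow> cls f \<oplus>\<^bsub>A\<^esub> cls g = cls (f + g)"
  using ring_hom_add[OF cls_ring_hom, of f g] by simp

lemma cls_mult: "f \<in> carrier kQ \<Longrightarrow> g \<in> carrier kQ \<Longrightarrow> cls f \<otimes>\<^bsub>A\<^esub> cls g = cls (f \<otimes>\<^bsub>kQ\<^esub> g)"
  using ring_hom_mult[OF cls_ring_hom, of f g] by simp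

text \<open>Elements of \<open>A\<close> have well-defined coefficients at the vertices and arrows, because \<open>J\<^sup>2\<close> is exactly the
  span of the longer paths.\<close>

lemma cls_eq_iff:
  assumes f: "f \<in> carrier kQ" and g: "g \<in> carrier kQ"
  shows "cls f = cls g \<longleftrightarrow>
    (\<forall>p. length (snd p) \<le> 1 \<longrightarrow> Poly_Mapping.lookup f p = Poly_Mapping.lookup g p)"
proof -
  interpret I: ideal "arrow_ideal_sq k Q" kQ by (rule ideal_arrow_ideal_sq)
  have uminus: "\<ominus>\<^bsub>kQ\<^esub> g = - g"
    using g by (intro I.minus_equality) auto
  have "cls f = cls g \<longleftrightarrow> f \<in> cls g"
    using f g I.a_repr_independence'[of f g] I.a_rcos_self[of f] by (auto simp: cls_def)
  also have "\<dots> \<longleftrightarrow> f \<oplus>\<^bsub>kQ\<^esub> \<ominus>\<^bsub>kQ\<^esub> g \<in> arrow_ideal_sq k Q"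
    unfolding cls_def by (rule I.a_rcos_module[OF g f])
  also have "\<dots> \<longleftrightarrow> f - g \<in> length_filtration 2"
    by (simp add: uminus arrow_ideal_sq_eq)
  also have "\<dots> \<longleftrightarrow>
    (\<forall>p. length (snd p) \<le> 1 \<longrightarrow> Poly_Mapping.lookup f p = Poly_Mapping.lookup g p)"
  proof
    assume L: "f - g \<in> length_filtration 2"
    have "p \<notin> Poly_Mapping.keys (f - g)" if "length (snd p) \<le> 1" for p
      using L that by (force simp: length_filtration_def)
    then show "\<forall>p. length (snd p) \<le> 1 \<longrightarrow> Poly_Mapping.lookup f p = Poly_Mapping.lookup g p"
      by (simp add: in_keys_iff lookup_minus)
  next
    assume *: "\<forall>p. length (snd p) \<le> 1 \<longrightarrow> Poly_Mapping.lookup f p = Poly_Mapping.lookup g p"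
    show "f - g \<in> length_filtration 2"
      unfolding length_filtration_def
    proof (intro CollectI subsetI)
      fix p assume p: "p \<in> Poly_Mapping.keys (f - g)"
      then have "p \<in> Poly_Mapping.keys f \<union> Poly_Mapping.keys g"
        by (auto simp: in_keys_iff lookup_minus)
      moreover have "Poly_Mapping.lookup f p \<noteq> Poly_Mapping.lookup g p"
        using p by (simp add: in_keys_iff lookup_minus)
      then have "\<not> length (snd p) \<le> 1" using * by blast
      ultimately show "p \<in> paths Q \<and> 2 \<le> length (snd p)" using f g by auto
    qed
  qed
  finally show ?thesis .
qed

lemma zero_A: "\<zero>\<^bsub>A\<^esub> = cls 0"
  using ring_hom_zero[OF cls_ring_hom ring_kQ ring_A] by simp

lemma path_class_eq: "path_class k Q p = cls (Poly_Mapping.single p 1)"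
  by (simp add: path_class_def cls_def)

section \<open>The projective modules at the vertices\<close>

definition local_basis :: "'v \<Rightarrow> ('v, 'e) path set"
  where "local_basis i = {r \<in> paths Q. fst r = i \<and> length (snd r) \<le> 1}"

lemma finite_local_basis: "finite (local_basis i)"
proof (rule finite_subset)
  show "local_basis i \<subseteq> insert (i, []) (Pair i ` (\<lambda>\<alpha>. [\<alpha>]) ` arcs Q)"
  proof
    fix r assume r: "r \<in> local_basis i"
    then show "r \<in> insert (i, []) (Pair i ` (\<lambda>\<alpha>. [\<alpha>]) ` arcs Q)"
      by (cases r; cases "snd r") (auto simp: local_basis_def)
  qed
qed simp

lemma lookup_mult_idempotent:
  "Poly_Mapping.lookup (f \<otimes>\<^bsub>kQ\<^esub> Poly_Mapping.single (trivial_path i) 1) p =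
    (if fst p = i then Poly_Mapping.lookup f p else 0)"
proof -
  obtain u w where p: "p = (u, w)" by (cases p)
  have "Poly_Mapping.lookup (f \<otimes>\<^bsub>kQ\<^esub> Poly_Mapping.single (trivial_path i) 1) p =
    (\<Sum>n\<le>length w. if n = 0 then (if fst p = i then Poly_Mapping.lookup f p else 0) else 0)"
    unfolding p lookup_mult_kQ
    by (intro sum.cong) (auto simp: lookup_single when_def trivial_path_def path_target_simp)
  then show ?thesis by simp
qed

lemma trivial_path_closed: "i \<in> verts Q \<Longrightarrow> Poly_Mapping.single (trivial_path i) 1 \<in> carrier kQ"
  by (simp add: trivial_path_def)

lemma left_module_proj_module: "i \<in> verts Q \<Longrightarrow> left_module A (proj_module k Q i)"
  unfolding proj_module_def path_class_eq
  by (intro ring.left_module_principal ring_A cls_closed trivial_path_closed)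

lemma proj_module_simps [simp]:
  "\<zero>\<^bsub>proj_module k Q i\<^esub> = cls 0"
  "x \<oplus>\<^bsub>proj_module k Q i\<^esub> y = x \<oplus>\<^bsub>A\<^esub> y"
  "a \<odot>\<^bsub>proj_module k Q i\<^esub> x = a \<otimes>\<^bsub>A\<^esub> x"
  by (simp_all add: proj_module_def principal_left_module_def zero_A)

text \<open>Multiplying by \<open>e\<^sub>i\<close> on the right keeps the paths starting at \<open>i\<close>; of these, only \<open>e\<^sub>i\<close> and the arrows
  survive modulo \<open>J\<^sup>2\<close>.\<close>

lemma carrier_proj_module:
  assumes i: "i \<in> verts Q"
  shows "carrier (proj_module k Q i) = cls ` {g. Poly_Mapping.keys g \<subseteq> local_basis i}"
proof -
  let ?e = "Poly_Mapping.single (trivial_path i) 1"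
  have carr: "carrier (proj_module k Q i) = (\<lambda>f. cls (f \<otimes>\<^bsub>kQ\<^esub> ?e)) ` carrier kQ"
  proof -
    have "carrier (proj_module k Q i) = (\<lambda>a. a \<otimes>\<^bsub>A\<^esub> cls ?e) ` carrier A"
      by (auto simp: proj_module_def principal_left_module_def path_class_eq)
    also have "\<dots> = (\<lambda>f. cls f \<otimes>\<^bsub>A\<^esub> cls ?e) ` carrier kQ"
      by (simp only: carrier_A image_image)
    also have "\<dots> = (\<lambda>f. cls (f \<otimes>\<^bsub>kQ\<^esub> ?e)) ` carrier kQ"
      by (rule image_cong) (simp_all only: cls_mult trivial_path_closed[OF i])
    finally show ?thesis .
  qed
  show ?thesis
  proof (intro equalityI subsetI)
    fix x assume "x \<in> carrier (proj_module k Q i)"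
    then obtain f where f: "f \<in> carrier kQ" "x = cls (f \<otimes>\<^bsub>kQ\<^esub> ?e)" unfolding carr by blast
    \<comment> \<open>\<open>g\<close> is the restriction of \<open>f\<close> to \<open>local_basis i\<close>.\<close>
    define g where "g = lin_ext (\<lambda>r. if r \<in> local_basis i then Poly_Mapping.single r 1 else 0) f"
    have lookup_g: "Poly_Mapping.lookup g r =
        (if r \<in> local_basis i then Poly_Mapping.lookup f r else 0)" for r
    proof -
      have "Poly_Mapping.lookup g r = (\<Sum>b\<in>Poly_Mapping.keys f.
          if b = r then (if r \<in> local_basis i then Poly_Mapping.lookup f r else 0) else 0)"
        unfolding g_def lin_ext_def lookup_sum
        by (intro sum.cong) (auto simp: lookup_single when_def)
      then show ?thesis by (simp add: in_keys_iff)
    qed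
    have g: "Poly_Mapping.keys g \<subseteq> local_basis i"
      by (metis (no_types, lifting) in_keys_iff lookup_g subsetI)
    moreover have "cls (f \<otimes>\<^bsub>kQ\<^esub> ?e) = cls g"
    proof (subst cls_eq_iff)
      show "f \<otimes>\<^bsub>kQ\<^esub> ?e \<in> carrier kQ"
        using f trivial_path_closed[OF i] mult_closed_kQ by blast
      show "g \<in> carrier kQ" using g by (auto simp: local_basis_def)
      show "\<forall>p. length (snd p) \<le> 1 \<longrightarrow>
          Poly_Mapping.lookup (f \<otimes>\<^bsub>kQ\<^esub> ?e) p = Poly_Mapping.lookup g p"
        using lookup_kQ_eq_0[OF f(1)]
        by (simp add: lookup_mult_idempotent lookup_g local_basis_def)
    qed
    ultimately show "x \<in> cls ` {g. Poly_Mapping.keys g \<subseteq> local_basis i}" using f by blast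
  next
    fix x assume "x \<in> cls ` {g. Poly_Mapping.keys g \<subseteq> local_basis i}"
    then obtain g where g: "Poly_Mapping.keys g \<subseteq> local_basis i" "x = cls g" by blast
    have "g \<otimes>\<^bsub>kQ\<^esub> ?e = g"
    proof (rule poly_mapping_eqI)
      fix p show "Poly_Mapping.lookup (g \<otimes>\<^bsub>kQ\<^esub> ?e) p = Poly_Mapping.lookup g p"
        using g by (cases p) (auto simp: lookup_mult_idempotent local_basis_def in_keys_iff)
    qed
    then show "x \<in> carrier (proj_module k Q i)"
      unfolding carr using g by (intro image_eqI[of _ _ g]) (auto simp: local_basis_def)
  qed
qed

end

section \<open>Coordinates on the modules of the complex\<close>

text \<open>The basis element \<open>r \<zeta>\<^bsub>(p,q)\<^esub>\<close> is represented by the pair \<open>(r, (p, q))\<close>, and an element of the complex by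
  its finitely supported coefficient function. The summand in which it lies is recovered from the
  starting vertex of \<open>r\<close>, which is where \<open>p\<close> ends.\<close>

type_synonym ('v, 'e, 'k) chain =
  "('v, 'e) path \<times> (('v, 'e) path \<times> ('v, 'e) path) \<Rightarrow>\<^sub>0 'k"

locale leavitt_quiver = quiver Q k for Q :: "('v, 'e) pre_digraph" and k :: "'k::field itself" +
  fixes assoc_arrow :: "'v \<Rightarrow> 'e"
  assumes assoc_arrow: "i \<in> verts Q \<Longrightarrow> assoc_arrow i \<in> arcs Q \<and> head Q (assoc_arrow i) = i"
begin

abbreviation \<Lambda> :: "int \<Rightarrow> 'v \<Rightarrow> (('v, 'e) path \<times> ('v, 'e) path) set"
  where "\<Lambda> \<equiv> leavitt_index Q assoc_arrow"

abbreviation M :: "int \<Rightarrow> ((('v, 'e) path \<Rightarrow>\<^sub>0 'k) set, ('v, 'e, 'k) leavitt_elem) module"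
  where "M \<equiv> leavitt_module k Q assoc_arrow"

definition basis :: "int \<Rightarrow> (('v, 'e) path \<times> (('v, 'e) path \<times> ('v, 'e) path)) set"
  where "basis l = {(r, pq). r \<in> paths Q \<and> length (snd r) \<le> 1 \<and> pq \<in> \<Lambda> l (fst r)}"

definition chains :: "int \<Rightarrow> ('v, 'e, 'k) chain set"
  where "chains l = {c. Poly_Mapping.keys c \<subseteq> basis l}"

definition slice :: "('v, 'e) path \<times> ('v, 'e) path \<Rightarrow> ('v, 'e, 'k) chain \<Rightarrow> ('v, 'e) path \<Rightarrow>\<^sub>0 'k"
  where "slice pq c = Poly_Mapping.map_key (\<lambda>r. (r, pq)) c"

definition of_chain :: "int \<Rightarrow> ('v, 'e, 'k) chain \<Rightarrow> ('v, 'e, 'k) leavitt_elem"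
  where "of_chain l c = (\<lambda>i\<in>verts Q. \<lambda>pq\<in>\<Lambda> l i. cls (slice pq c))"

lemma lookup_slice [simp]: "Poly_Mapping.lookup (slice pq c) r = Poly_Mapping.lookup c (r, pq)"
  by (simp add: slice_def map_key.rep_eq inj_on_def)

lemma slice_add: "slice pq (c + d) = slice pq c + slice pq d"
  by (rule poly_mapping_eqI) (simp add: lookup_add)

lemma slice_single:
  "slice pq (Poly_Mapping.single (r, pq') a) = (if pq = pq' then Poly_Mapping.single r a else 0)"
  by (rule poly_mapping_eqI) (auto simp: lookup_single when_def)

lemma index_target: "pq \<in> \<Lambda> l i \<Longrightarrow> path_target Q (fst pq) = i"
  by (auto simp: leavitt_index_def)

lemma keys_slice:
  assumes "c \<in> chains l" "pq \<in> \<Lambda> l i"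
  shows "Poly_Mapping.keys (slice pq c) \<subseteq> local_basis i"
proof
  fix r assume "r \<in> Poly_Mapping.keys (slice pq c)"
  then have "(r, pq) \<in> basis l" using assms(1) by (auto simp: chains_def in_keys_iff)
  then show "r \<in> local_basis i"
    using index_target[OF assms(2)] index_target[of pq l "fst r"]
    by (auto simp: basis_def local_basis_def)
qed

lemma slice_closed: "c \<in> chains l \<Longrightarrow> pq \<in> \<Lambda> l i \<Longrightarrow> slice pq c \<in> carrier kQ"
  using keys_slice[of c l pq i] by (auto simp: local_basis_def)

lemma chains_add: "c \<in> chains l \<Longrightarrow> d \<in> chains l \<Longrightarrow> c + d \<in> chains l"
  using keys_add[of c d] by (auto simp: chains_def)

lemma chains_scale: "c \<in> chains l \<Longrightarrow> scale a c \<in> chains l"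
  by (auto simp: chains_def in_keys_iff subset_iff)

lemma chains_zero [simp]: "0 \<in> chains l"
  by (simp add: chains_def)

lemma chains_single: "b \<in> basis l \<Longrightarrow> Poly_Mapping.single b a \<in> chains l"
  by (simp add: chains_def)

lemma chains_sum: "(\<And>x. x \<in> S \<Longrightarrow> f x \<in> chains l) \<Longrightarrow> sum f S \<in> chains l"
  unfolding chains_def mem_Collect_eq by (rule keys_sum_subset)

lemma chains_lin_ext:
  assumes "c \<in> chains l" "\<And>b. b \<in> basis l \<Longrightarrow> \<phi> b \<in> chains l'"
  shows "lin_ext \<phi> c \<in> chains l'"
  using assms unfolding chains_def mem_Collect_eq by (intro keys_lin_ext) blast

lemma left_module_M: "left_module A (M l)"
  unfolding leavitt_module_def
  by (intro left_module_direct_sum ring_A left_module_proj_module)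

lemma abelian_group_M: "abelian_group (M l)"
  using left_module_M by (simp add: left_module_def)

lemma M_simps:
  "x \<oplus>\<^bsub>M l\<^esub> y = (\<lambda>i\<in>verts Q. \<lambda>pq\<in>\<Lambda> l i. x i pq \<oplus>\<^bsub>A\<^esub> y i pq)"
  "\<zero>\<^bsub>M l\<^esub> = (\<lambda>i\<in>verts Q. \<lambda>pq\<in>\<Lambda> l i. cls 0)"
  "a \<odot>\<^bsub>M l\<^esub> x = (\<lambda>i\<in>verts Q. \<lambda>pq\<in>\<Lambda> l i. a \<otimes>\<^bsub>A\<^esub> x i pq)"
  by (simp_all add: leavitt_module_def direct_sum_def)

lemma carrier_M:
  "x \<in> carrier (M l) \<longleftrightarrow> x \<in> extensional (verts Q) \<and> (\<forall>i\<in>verts Q. x i \<in> extensional (\<Lambda> l i) \<and>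
    (\<forall>pq\<in>\<Lambda> l i. x i pq \<in> carrier (proj_module k Q i)) \<and> finite {pq \<in> \<Lambda> l i. x i pq \<noteq> cls 0})"
  by (auto simp: leavitt_module_def direct_sum_def PiE_iff)

lemma of_chain_closed:
  assumes c: "c \<in> chains l"
  shows "of_chain l c \<in> carrier (M l)"
proof -
  have "finite {pq \<in> \<Lambda> l i. of_chain l c i pq \<noteq> cls 0}" if i: "i \<in> verts Q" for i
  proof (rule finite_subset)
    show "{pq \<in> \<Lambda> l i. of_chain l c i pq \<noteq> cls 0} \<subseteq> snd ` Poly_Mapping.keys c"
    proof
      fix pq assume pq: "pq \<in> {pq \<in> \<Lambda> l i. of_chain l c i pq \<noteq> cls 0}"
      show "pq \<in> snd ` Poly_Mapping.keys c"
      proof (rule ccontr)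
        assume "pq \<notin> snd ` Poly_Mapping.keys c"
        then have "slice pq c = 0"
          by (intro poly_mapping_eqI) (force simp: in_keys_iff)
        then show False using pq i by (auto simp: of_chain_def)
      qed
    qed
  qed simp
  then show ?thesis
    using keys_slice[OF c] by (auto simp: carrier_M carrier_proj_module of_chain_def)
qed

lemma of_chain_add: "c \<in> chains l \<Longrightarrow> d \<in> chains l \<Longrightarrow> of_chain l (c + d) = of_chain l c \<oplus>\<^bsub>M l\<^esub> of_chain l d"
  using slice_closed
  by (auto simp: M_simps of_chain_def slice_add cls_add fun_eq_iff)

lemma of_chain_zero [simp]: "of_chain l 0 = \<zero>\<^bsub>M l\<^esub>"
proof -
  have "slice pq 0 = 0" for pq by (rule poly_mapping_eqI) simp
  then show ?thesis by (simp add: M_simps of_chain_def)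
qed

text \<open>The coefficients of a product at paths of length at most one determine its class, so the action of
  \<open>A\<close> can be computed on representatives, one \<open>\<zeta>\<^bsub>(p,q)\<^esub>\<close> at a time.\<close>

lemma smult_of_chain:
  assumes "f \<in> carrier kQ" "c \<in> chains l" "d \<in> chains l"
    and "\<And>r pq. length (snd r) \<le> 1 \<Longrightarrow>
      Poly_Mapping.lookup (f \<otimes>\<^bsub>kQ\<^esub> slice pq c) r = Poly_Mapping.lookup d (r, pq)"
  shows "cls f \<odot>\<^bsub>M l\<^esub> of_chain l c = of_chain l d"
proof -
  have "cls f \<otimes>\<^bsub>A\<^esub> cls (slice pq c) = cls (slice pq d)" if pq: "pq \<in> \<Lambda> l i" for pq i
  proof -
    have "cls (f \<otimes>\<^bsub>kQ\<^esub> slice pq c) = cls (slice pq d)"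
      using assms mult_closed_kQ[OF assms(1) slice_closed[OF assms(2) pq]] slice_closed[OF assms(3) pq]
      by (subst cls_eq_iff) auto
    then show ?thesis
      using cls_mult[OF assms(1) slice_closed[OF assms(2) pq]] by simp
  qed
  then show ?thesis by (auto simp: M_simps of_chain_def fun_eq_iff)
qed

lemma of_chain_inj:
  assumes "c \<in> chains l" "d \<in> chains l" "of_chain l c = of_chain l d"
  shows "c = d"
proof (rule poly_mapping_eqI)
  fix b :: "('v, 'e) path \<times> ('v, 'e) path \<times> ('v, 'e) path"
  obtain r pq where b: "b = (r, pq)" by (cases b)
  show "Poly_Mapping.lookup c b = Poly_Mapping.lookup d b"
  proof (cases "b \<in> basis l")
    case True
    then have pq: "pq \<in> \<Lambda> l (fst r)" "length (snd r) \<le> 1" "fst r \<in> verts Q"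
      using path_source_in_verts by (auto simp: b basis_def)
    then have "of_chain l c (fst r) pq = of_chain l d (fst r) pq" using assms by simp
    then have "cls (slice pq c) = cls (slice pq d)" using pq by (simp add: of_chain_def)
    then have "Poly_Mapping.lookup (slice pq c) r = Poly_Mapping.lookup (slice pq d) r"
      using pq cls_eq_iff[OF slice_closed[OF assms(1) pq(1)] slice_closed[OF assms(2) pq(1)]]
      by blast
    then show ?thesis by (simp add: b)
  next
    case False
    then have "b \<notin> Poly_Mapping.keys c" "b \<notin> Poly_Mapping.keys d"
      using assms(1,2) by (auto simp: chains_def)
    then show ?thesis by (simp add: in_keys_iff)
  qed
qed

text \<open>Each coordinate of \<open>x\<close> has a representative supported on \<open>e\<^sub>i\<close> and the arrows starting at \<open>i\<close>; there are
  finitely many vertices, finitely many nonzero coordinates at each of them, and finitely many such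
  paths, so the representatives fit together to a finitely supported function.\<close>

lemma of_chain_surj:
  assumes x: "x \<in> carrier (M l)"
  obtains c where "c \<in> chains l" "x = of_chain l c"
proof -
  have "\<exists>g. Poly_Mapping.keys g \<subseteq> local_basis i \<and> x i pq = cls g"
    if "i \<in> verts Q" "pq \<in> \<Lambda> l i" for i pq
  proof -
    have "x i pq \<in> carrier (proj_module k Q i)" using x that by (simp add: carrier_M)
    then show ?thesis unfolding carrier_proj_module[OF that(1)] by blast
  qed
  then obtain G where G: "\<And>i pq. i \<in> verts Q \<Longrightarrow> pq \<in> \<Lambda> l i \<Longrightarrow>
      Poly_Mapping.keys (G i pq) \<subseteq> local_basis i \<and> x i pq = cls (G i pq)"
    by metis
  have Gc: "G i pq \<in> carrier kQ" if "i \<in> verts Q" "pq \<in> \<Lambda> l i" for i pq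
    using G[OF that] by (auto simp: local_basis_def)
  define F where "F = (\<lambda>(r, pq). if (r, pq) \<in> basis l then Poly_Mapping.lookup (G (fst r) pq) r else 0)"
  have "finite {b. F b \<noteq> 0}"
  proof (rule finite_subset)
    show "{b. F b \<noteq> 0} \<subseteq>
        (\<Union>i\<in>verts Q. local_basis i \<times> {pq \<in> \<Lambda> l i. x i pq \<noteq> cls 0})"
    proof
      fix b assume "b \<in> {b. F b \<noteq> 0}"
      then obtain r pq where b: "b = (r, pq)" "(r, pq) \<in> basis l"
        and nz: "Poly_Mapping.lookup (G (fst r) pq) r \<noteq> 0"
        by (cases b) (auto simp: F_def split: if_splits)
      have r: "fst r \<in> verts Q" "pq \<in> \<Lambda> l (fst r)" "r \<in> local_basis (fst r)" "length (snd r) \<le> 1"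
        using b path_source_in_verts by (auto simp: basis_def local_basis_def)
      have "cls (G (fst r) pq) \<noteq> cls 0"
      proof
        assume "cls (G (fst r) pq) = cls 0"
        then have "Poly_Mapping.lookup (G (fst r) pq) r = Poly_Mapping.lookup 0 r"
          using r(4) cls_eq_iff[OF Gc[OF r(1,2)], of 0] by (metis kQ_simps(1) keys_zero empty_subsetI mem_Collect_eq)
        then show False using nz by simp
      qed
      then show "b \<in> (\<Union>i\<in>verts Q. local_basis i \<times> {pq \<in> \<Lambda> l i. x i pq \<noteq> cls 0})"
        using G[of "fst r" pq] r b by auto
    qed
  qed (use x in \<open>auto simp: carrier_M finite_local_basis\<close>)
  then have lookup: "Poly_Mapping.lookup (Abs_poly_mapping F) = F" by simp
  have chain: "Abs_poly_mapping F \<in> chains l"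
    by (auto simp: chains_def in_keys_iff lookup) (auto simp: F_def split: if_splits)
  have "x i pq = cls (slice pq (Abs_poly_mapping F))" if i: "i \<in> verts Q" "pq \<in> \<Lambda> l i" for i pq
  proof -
    have "Poly_Mapping.lookup (G i pq) r = F (r, pq)" if r: "length (snd r) \<le> 1" for r
    proof (cases "r \<in> local_basis i")
      case True
      then show ?thesis using i r by (auto simp: F_def basis_def local_basis_def)
    next
      case False
      then have "Poly_Mapping.lookup (G i pq) r = 0" using G[OF i] by (auto simp: in_keys_iff)
      moreover have "(r, pq) \<notin> basis l"
        using False index_target[OF i(2)] index_target[of pq l "fst r"]
        by (auto simp: basis_def local_basis_def)
      ultimately show ?thesis by (simp add: F_def)
    qed
    then have "cls (G i pq) = cls (slice pq (Abs_poly_mapping F))"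
      using Gc[OF i] slice_closed[OF chain i(2)] by (subst cls_eq_iff) (auto simp: lookup)
    then show ?thesis using G[OF i] by simp
  qed
  then have "x = of_chain l (Abs_poly_mapping F)"
    using x by (auto simp: of_chain_def carrier_M fun_eq_iff extensional_def)
  then show ?thesis using that chain by blast
qed

lemma zeta_eq_of_chain:
  assumes "(r, pq) \<in> basis l"
  shows "zeta k Q assoc_arrow l r pq = of_chain l (Poly_Mapping.single (r, pq) 1)"
proof -
  have pq: "pq \<in> \<Lambda> l (fst r)"
    using assms by (auto simp: basis_def)
  note i = index_target[OF pq]
  have "pq \<notin> \<Lambda> l j" if "j \<noteq> fst r" for j
    using that i index_target[of pq l j] by auto
  then show ?thesis
    unfolding zeta_def i Let_def direct_sum_inj_def of_chain_def
    by (auto simp: slice_single path_class_eq fun_eq_iff direct_sum_def)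
qed

lemma of_chain_scale:
  assumes "c \<in> chains l"
  shows "of_chain l (scale a c) = scalar_class k Q a \<odot>\<^bsub>M l\<^esub> of_chain l c"
proof -
  let ?s = "\<Sum>i\<in>verts Q. Poly_Mapping.single (trivial_path i) a"
  have "?s \<in> carrier kQ" by (rule idempotents_closed)
  moreover have "scalar_class k Q a = cls ?s" by (simp add: scalar_class_def cls_def)
  moreover have "Poly_Mapping.lookup (?s \<otimes>\<^bsub>kQ\<^esub> slice pq c) r = Poly_Mapping.lookup (scale a c) (r, pq)" for r pq
  proof -
    have "slice pq c \<in> carrier kQ"
      using assms by (auto simp: chains_def basis_def in_keys_iff)
    then show ?thesis by (simp add: lookup_mult_scalar)
  qed
  ultimately show ?thesis using smult_of_chain assms chains_scale by metis
qed

text \<open>Left multiplication by the path \<open>s\<close> in \<open>A\<close>, where products of length two or more vanish.\<close>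

definition path_act :: "('v, 'e) path \<Rightarrow> ('v, 'e) path \<times> (('v, 'e) path \<times> ('v, 'e) path) \<Rightarrow> ('v, 'e, 'k) chain"
  where "path_act s = (\<lambda>(r, pq). if fst s = path_target Q r \<and> length (snd s) + length (snd r) \<le> 1
    then Poly_Mapping.single (path_comp s r, pq) 1 else 0)"

lemma chains_path_act:
  assumes "s \<in> paths Q" "b \<in> basis l"
  shows "path_act s b \<in> chains l"
  using assms path_comp_mem_paths[of s "fst b"]
  by (auto simp: path_act_def basis_def path_comp_def intro!: chains_single)

lemma smult_path_of_chain:
  assumes s: "s \<in> paths Q" and c: "c \<in> chains l"
  shows "cls (Poly_Mapping.single s a) \<odot>\<^bsub>M l\<^esub> of_chain l c = of_chain l (scale a (lin_ext (path_act s) c))"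
proof (rule smult_of_chain[OF _ c])
  show "Poly_Mapping.single s a \<in> carrier kQ" using s by simp
  show "scale a (lin_ext (path_act s) c) \<in> chains l"
    by (intro chains_scale chains_lin_ext[OF c] chains_path_act s)
  fix r pq assume r: "length (snd (r :: ('v, 'e) path)) \<le> 1"
  have "Poly_Mapping.keys c \<subseteq> UNIV" by simp
  then show "Poly_Mapping.lookup (Poly_Mapping.single s a \<otimes>\<^bsub>kQ\<^esub> slice pq c) r =
      Poly_Mapping.lookup (scale a (lin_ext (path_act s) c)) (r, pq)"
  proof (induction rule: additive_induct)
    case zero
    have "slice pq 0 = 0" by (rule poly_mapping_eqI) simp
    then show ?case by simp
  next
    case (single b a')
    obtain r' pq' where b: "b = (r', pq')" by (cases b)
    show ?case
      using r by (auto simp: b slice_single mult_single_kQ path_act_def lookup_single when_def path_comp_def)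
  next
    case (add c d)
    then show ?case by (simp add: slice_add mult_add_right_kQ lin_ext_add lookup_add distrib_left)
  qed
qed


section \<open>The differential and a contracting homotopy in coordinates\<close>

abbreviation compatible :: "'e list \<Rightarrow> 'e list \<Rightarrow> bool"
  where "compatible v w \<equiv>
    v = [] \<or> w = [] \<or> hd v \<noteq> hd w \<or> hd v \<noteq> assoc_arrow (head Q (hd v))"

lemma snd_trivial_path: "snd (trivial_path i) = []"
  by (simp add: trivial_path_def)

text \<open>In the definition of the associated pairs, the pairs with a trivial component are listed separately;
  here they are absorbed into a condition on the two lists of arrows.\<close>

lemma mem_index_iff:
  "((u, v), (u', w)) \<in> \<Lambda> l i \<longleftrightarrow> u' = u \<and> (u, v) \<in> paths Q \<and> (u, w) \<in> paths Q \<and> compatible v w \<and>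
    int (length w) - int (length v) = l \<and> path_target Q (u, v) = i"
  by (auto simp: leavitt_index_def assoc_pairs_def trivial_path_def Let_def dest: path_source_in_verts)

lemma chains_diff:
  assumes "c \<in> chains l" "d \<in> chains l"
  shows "c - d \<in> chains l"
proof -
  have "c - d = c + scale (- 1) d"
    by (rule poly_mapping_eqI) (simp add: lookup_minus lookup_add)
  then show ?thesis by (simp only: chains_add chains_scale assms)
qed

fun d_basis :: "('v, 'e) path \<times> (('v, 'e) path \<times> ('v, 'e) path) \<Rightarrow> ('v, 'e, 'k) chain"
  where "d_basis (r, (p, q)) =
    (if snd r \<noteq> [] then 0
     else if snd p = [] then \<Sum>\<beta>\<in>{\<beta> \<in> arcs Q. head Q \<beta> = fst r}.
       Poly_Mapping.single (arrow_path Q \<beta>, (trivial_path (tail Q \<beta>), path_comp q (arrow_path Q \<beta>))) 1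
     else Poly_Mapping.single (arrow_path Q (last (snd p)), (path_hat p, q)) 1)"

text \<open>The contracting homotopy: it inverts the differential on arrow symbols. The symbol
  \<open>\<beta> \<zeta>\<^bsub>(p,q)\<^esub>\<close> comes from \<open>e \<zeta>\<^bsub>(\<beta>p,q)\<^esub>\<close>, except when this is no associated pair. In that case \<open>p\<close> is
  trivial and \<open>q = q'\<beta>\<close> with \<open>\<beta>\<close> associated; then \<open>\<beta> \<zeta>\<^bsub>(p,q)\<^esub>\<close> is one summand of the image of
  \<open>e \<zeta>\<^bsub>(e,q')\<^esub>\<close>, and the preimages \<open>e \<zeta>\<^bsub>(\<gamma>,q'\<gamma>)\<^esub>\<close> of the other summands \<open>\<gamma> \<zeta>\<^bsub>(e,q'\<gamma>)\<^esub>\<close> are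
  subtracted; they are available because \<open>\<gamma>\<close> ends at the same vertex as \<open>\<beta>\<close> and is therefore not
  associated.\<close>

fun h_basis :: "('v, 'e) path \<times> (('v, 'e) path \<times> ('v, 'e) path) \<Rightarrow> ('v, 'e, 'k) chain"
  where "h_basis ((u, []), (p, q)) = 0"
  | "h_basis ((u, \<beta> # r), (p, q)) =
      (let i = head Q \<beta> in
       if snd p = [] \<and> snd q \<noteq> [] \<and> hd (snd q) = \<beta> \<and> \<beta> = assoc_arrow i
       then Poly_Mapping.single ((i, []), ((i, []), (i, tl (snd q)))) 1 -
         (\<Sum>\<gamma>\<in>{\<gamma> \<in> arcs Q. head Q \<gamma> = i} - {\<beta>}.
           Poly_Mapping.single ((i, []), ((tail Q \<gamma>, [\<gamma>]), (tail Q \<gamma>, \<gamma> # tl (snd q)))) 1)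
       else Poly_Mapping.single ((i, []), ((fst p, snd p @ [\<beta>]), q)) 1)"

lemma basis_cases:
  assumes "b \<in> basis l"
  obtains (trivial_trivial) i w where "b = ((i, []), ((i, []), (i, w)))"
      "((i, []), (i, w)) \<in> \<Lambda> l i"
    | (trivial_snoc) i u v \<beta> w where "b = ((i, []), ((u, v @ [\<beta>]), (u, w)))"
      "((u, v @ [\<beta>]), (u, w)) \<in> \<Lambda> l i"
    | (arrow) \<beta> u v w where "b = ((tail Q \<beta>, [\<beta>]), ((u, v), (u, w)))" "\<beta> \<in> arcs Q"
      "((u, v), (u, w)) \<in> \<Lambda> l (tail Q \<beta>)"
proof -
  obtain i r u v u' w where b: "b = ((i, r), ((u, v), (u', w)))"
    by (cases b; cases "fst b"; cases "fst (snd b)"; cases "snd (snd b)") auto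
  have u': "u' = u" and i: "((u, v), (u, w)) \<in> \<Lambda> l i"
    using assms by (auto simp: b basis_def mem_index_iff)
  show ?thesis
  proof (cases r)
    case Nil
    show ?thesis
    proof (cases v rule: rev_cases)
      case Nil
      then have "i = u" using i by (auto simp: mem_index_iff path_target_simp)
      then show ?thesis using trivial_trivial b u' i Nil \<open>r = []\<close> by simp
    next
      case (snoc v' \<beta>)
      then show ?thesis using trivial_snoc b u' i \<open>r = []\<close> by simp
    qed
  next
    case (Cons \<beta> r')
    then show ?thesis using assms arrow[of \<beta> u v w] i by (auto simp: b basis_def u')
  qed
qed

lemma d_basis_closed:
  assumes "b \<in> basis l"
  shows "d_basis b \<in> chains (l + 1)"
  using assms
proof (cases rule: basis_cases)
  case (trivial_trivial i w)
  then show ?thesis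
    by (auto simp: trivial_path_def arrow_path_def path_comp_def basis_def mem_index_iff path_target_simp
        intro!: chains_sum chains_single)
next
  case (trivial_snoc i u v \<beta> w)
  then show ?thesis
    by (auto simp: arrow_path_def path_hat_def basis_def mem_index_iff append_mem_paths hd_append
        intro!: chains_single split: if_splits)
next
  case (arrow \<beta> u v w)
  then show ?thesis by simp
qed

lemma h_basis_closed:
  assumes "b \<in> basis (l + 1)"
  shows "h_basis b \<in> chains l"
  using assms
proof (cases rule: basis_cases)
  case (trivial_trivial i w)
  then show ?thesis by simp
next
  case (trivial_snoc i u v \<beta> w)
  then show ?thesis by simp
next
  case (arrow \<beta> u v w)
  show ?thesis
  proof (cases "v = [] \<and> w \<noteq> [] \<and> hd w = \<beta> \<and> \<beta> = assoc_arrow (head Q \<beta>)")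
    case True
    then obtain w' where w: "w = \<beta> # w'" by (cases w) auto
    show ?thesis
      unfolding arrow(1) h_basis.simps Let_def using True arrow
      by (auto simp: w basis_def mem_index_iff path_target_simp intro!: chains_diff chains_sum chains_single)
  next
    case False
    then show ?thesis
      using arrow
      by (auto simp: basis_def mem_index_iff append_mem_paths path_target_simp hd_append
          intro!: chains_single split: if_splits)
  qed
qed

text \<open>On a trivial symbol only \<open>h d\<close> contributes, on an arrow symbol only \<open>d h\<close>. The associated arrow ending
  at a given vertex being unique, exactly one summand of the image of \<open>e \<zeta>\<^bsub>(e,q)\<^esub>\<close> is of the exceptional
  kind, and the correction terms in its preimage cancel the preimages of all other summands.\<close>

lemma homotopy_basis:
  assumes "b \<in> basis l"
  shows "lin_ext d_basis (h_basis b) + lin_ext h_basis (d_basis b) = Poly_Mapping.single b 1"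
  using assms
proof (cases rule: basis_cases)
  case (trivial_trivial i w)
  \<comment> \<open>The summand at the associated arrow \<open>?a\<close> is the exceptional one.\<close>
  let ?a = "assoc_arrow i"
  let ?S = "{\<gamma> \<in> arcs Q. head Q \<gamma> = i}"
  let ?s = "\<lambda>\<gamma>. Poly_Mapping.single ((i, []), ((tail Q \<gamma>, [\<gamma>]), (tail Q \<gamma>, \<gamma> # w))) (1 :: 'k)"
  have a: "?a \<in> ?S"
    using assoc_arrow[of i] trivial_trivial(2) by (auto simp: mem_index_iff)
  have "lin_ext h_basis (d_basis b) =
      (\<Sum>\<gamma>\<in>?S. h_basis ((tail Q \<gamma>, [\<gamma>]), ((tail Q \<gamma>, []), (tail Q \<gamma>, \<gamma> # w))))"
    by (simp add: trivial_trivial(1) lin_ext_sum arrow_path_def trivial_path_def path_comp_def)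
  also have "\<dots> = (Poly_Mapping.single b 1 - sum ?s (?S - {?a})) +
      (\<Sum>\<gamma>\<in>?S - {?a}. h_basis ((tail Q \<gamma>, [\<gamma>]), ((tail Q \<gamma>, []), (tail Q \<gamma>, \<gamma> # w))))"
    using a by (subst sum.remove[OF _ a]) (auto simp: trivial_trivial(1))
  also have "\<dots> = (Poly_Mapping.single b 1 - sum ?s (?S - {?a})) + sum ?s (?S - {?a})"
    by (intro arg_cong2[where f = "(+)"] refl sum.cong) auto
  finally show ?thesis by (simp add: trivial_trivial(1))
next
  case (trivial_snoc i u v \<beta> w)
  then show ?thesis
    by (auto simp: arrow_path_def path_hat_def mem_index_iff path_target_simp)
next
  case (arrow \<beta> u v w)
  show ?thesis
  proof (cases "v = [] \<and> w \<noteq> [] \<and> hd w = \<beta> \<and> \<beta> = assoc_arrow (head Q \<beta>)")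
    case True
    let ?i = "head Q \<beta>"
    let ?S = "{\<gamma> \<in> arcs Q. head Q \<gamma> = ?i}"
    obtain w' where w: "w = \<beta> # w'" using True by (cases w) auto
    let ?t = "\<lambda>\<gamma>. Poly_Mapping.single ((tail Q \<gamma>, [\<gamma>]), ((tail Q \<gamma>, []), (tail Q \<gamma>, \<gamma> # w'))) (1 :: 'k)"
    have u: "u = tail Q \<beta>" using arrow(3) by (auto simp: w mem_index_iff)
    have minus: "lin_ext d_basis (c - d) = lin_ext d_basis c - lin_ext d_basis d" for c d
      using lin_ext_add[of d_basis "c - d" d] by simp
    have cond: "snd (u, v) = [] \<and> snd (u, w) \<noteq> [] \<and> hd (snd (u, w)) = \<beta> \<and> \<beta> = assoc_arrow ?i"
      unfolding snd_conv by (rule True)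
    have "h_basis b = Poly_Mapping.single ((?i, []), ((?i, []), (?i, w'))) 1 -
        (\<Sum>\<gamma>\<in>?S - {\<beta>}. Poly_Mapping.single ((?i, []), ((tail Q \<gamma>, [\<gamma>]), (tail Q \<gamma>, \<gamma> # w'))) 1)"
      unfolding arrow(1) h_basis.simps Let_def if_P[OF cond] by (simp add: w)
    then have "lin_ext d_basis (h_basis b) = sum ?t ?S - sum ?t (?S - {\<beta>})"
      by (simp add: minus lin_ext_sum arrow_path_def trivial_path_def path_comp_def path_hat_def)
    also have "sum ?t ?S = ?t \<beta> + sum ?t (?S - {\<beta>})"
      using arrow(2) by (subst sum.remove[of _ \<beta>]) auto
    finally show ?thesis using conjunct1[OF True] by (simp add: arrow(1) w u)
  next
    case False
    have "h_basis b = Poly_Mapping.single ((head Q \<beta>, []), ((u, v @ [\<beta>]), (u, w))) 1"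
      unfolding arrow(1) h_basis.simps Let_def snd_conv fst_conv using False by (simp only: if_False)
    then show ?thesis by (simp add: arrow(1) arrow_path_def path_hat_def)
  qed
qed

abbreviation D :: "('v, 'e, 'k) chain \<Rightarrow> ('v, 'e, 'k) chain"
  where "D \<equiv> lin_ext d_basis"

abbreviation H :: "('v, 'e, 'k) chain \<Rightarrow> ('v, 'e, 'k) chain"
  where "H \<equiv> lin_ext h_basis"

lemma D_closed: "c \<in> chains l \<Longrightarrow> D c \<in> chains (l + 1)"
  using chains_lin_ext d_basis_closed by blast

lemma H_closed: "c \<in> chains (l + 1) \<Longrightarrow> H c \<in> chains l"
  using chains_lin_ext h_basis_closed by blast

lemma D_D: "D (D c) = 0"
proof -
  have "D (d_basis b) = 0" for b
    by (cases b rule: d_basis.cases) (auto simp: lin_ext_sum arrow_path_def)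
  then show ?thesis by (simp add: lin_ext_lin_ext lin_ext_zero_fun)
qed

lemma homotopy: "c \<in> chains l \<Longrightarrow> D (H c) + H (D c) = c"
  using homotopy_basis[of _ l]
  by (subst (3) lin_ext_id[of c, symmetric])
    (auto simp: lin_ext_lin_ext lin_ext_plus_fun chains_def intro!: lin_ext_cong)

text \<open>The image of \<open>e\<^sub>i \<zeta>\<^bsub>(p,q)\<^esub>\<close> is a sum of arrow symbols whose arrows end at \<open>i\<close>. So the trivial path at \<open>i\<close>
  fixes both this symbol and its image, and the other trivial paths kill both. An arrow kills the
  image, and it takes the symbol to zero or to an arrow symbol, on which the differential vanishes.\<close>

lemma D_path_act:
  assumes "c \<in> chains l"
  shows "D (lin_ext (path_act s) c) = lin_ext (path_act s) (D c)"
proof -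
  obtain u x where s: "s = (u, x)" by (cases s)
  have "D (path_act s b) = lin_ext (path_act s) (d_basis b)" if "b \<in> basis l" for b
    using that
  proof (cases rule: basis_cases)
    case (trivial_trivial i w)
    show ?thesis
    proof (cases "x = []")
      case True
      then show ?thesis
        by (auto simp: trivial_trivial(1) s path_act_def path_comp_def path_target_simp lin_ext_sum
            arrow_path_def trivial_path_def intro!: sum.cong)
    next
      case False
      then show ?thesis
        by (auto simp: trivial_trivial(1) s path_act_def path_comp_def lin_ext_sum arrow_path_def)
    qed
  next
    case (trivial_snoc i u' v \<beta> w)
    then have "head Q \<beta> = i" by (simp add: mem_index_iff path_target_simp)
    then show ?thesis
      by (cases x) (auto simp: trivial_snoc(1) s path_act_def path_comp_def path_target_simp arrow_path_def)
  next
    case (arrow \<beta> u' v w)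
    then show ?thesis by (auto simp: path_act_def path_comp_def)
  qed
  then show ?thesis
    using assms by (auto simp: lin_ext_lin_ext chains_def intro!: lin_ext_cong)
qed

section \<open>The differential of the projective Leavitt complex\<close>

text \<open>A general element of \<open>A\<close> is a sum of multiples of paths. The chain \<open>d\<close> representing its action on \<open>c\<close> is
  left implicit, which makes the two claims pass to sums together.\<close>

lemma smult_of_chain_D:
  assumes f: "f \<in> carrier kQ" and c: "c \<in> chains l"
  shows "\<exists>d\<in>chains l. cls f \<odot>\<^bsub>M l\<^esub> of_chain l c = of_chain l d \<and>
    cls f \<odot>\<^bsub>M (l + 1)\<^esub> of_chain (l + 1) (D c) = of_chain (l + 1) (D d)"
proof -
  have "Poly_Mapping.keys f \<subseteq> paths Q" using f by simp
  then show ?thesis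
  proof (induction rule: additive_induct)
    case zero
    have "cls 0 \<odot>\<^bsub>M l'\<^esub> of_chain l' c' = of_chain l' 0" if "c' \<in> chains l'" for c' l'
      by (rule smult_of_chain) (use that in \<open>auto simp: path_algebra_def\<close>)
    then show ?case using c D_closed[OF c] by (intro bexI[of _ 0]) auto
  next
    case (single s a)
    then show ?case
      using c D_closed[OF c] smult_path_of_chain[OF single]
      by (intro bexI[of _ "scale a (lin_ext (path_act s) c)"])
        (auto simp: lin_ext_scale D_path_act[OF c] intro!: chains_scale chains_lin_ext[OF c] chains_path_act)
  next
    case (add f g)
    then obtain d e where de: "d \<in> chains l" "e \<in> chains l"
      "cls f \<odot>\<^bsub>M l\<^esub> of_chain l c = of_chain l d" "cls g \<odot>\<^bsub>M l\<^esub> of_chain l c = of_chain l e"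
      "cls f \<odot>\<^bsub>M (l + 1)\<^esub> of_chain (l + 1) (D c) = of_chain (l + 1) (D d)"
      "cls g \<odot>\<^bsub>M (l + 1)\<^esub> of_chain (l + 1) (D c) = of_chain (l + 1) (D e)"
      by blast
    have fg: "f \<in> carrier kQ" "g \<in> carrier kQ" using add by auto
    have "cls (f + g) \<odot>\<^bsub>M l'\<^esub> of_chain l' c' = cls f \<odot>\<^bsub>M l'\<^esub> of_chain l' c' \<oplus>\<^bsub>M l'\<^esub> cls g \<odot>\<^bsub>M l'\<^esub> of_chain l' c'"
      if "c' \<in> chains l'" for c' l'
      using left_module.smult_l_distr[OF left_module_M cls_closed[OF fg(1)] cls_closed[OF fg(2)] of_chain_closed[OF that]]
      by (simp only: cls_add[OF fg])
    then show ?case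
      using de c D_closed
      by (intro bexI[of _ "d + e"]) (auto simp: of_chain_add lin_ext_add chains_add)
  qed
qed

definition \<delta> :: "int \<Rightarrow> ('v, 'e, 'k) leavitt_elem \<Rightarrow> ('v, 'e, 'k) leavitt_elem"
  where "\<delta> l = (\<lambda>x\<in>carrier (M l). of_chain (l + 1) (D (inv_into (chains l) (of_chain l) x)))"

lemma \<delta>_of_chain: "c \<in> chains l \<Longrightarrow> \<delta> l (of_chain l c) = of_chain (l + 1) (D c)"
  using of_chain_inj by (simp add: \<delta>_def of_chain_closed inv_into_f_f inj_on_def)

lemma \<delta>_linear: "\<delta> l \<in> linear_maps (carrier A) (M l) (M (l + 1))"
  unfolding linear_maps_def
proof (intro CollectI conjI Pi_I ballI)
  fix x assume "x \<in> carrier (M l)"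
  then obtain c where c: "c \<in> chains l" "x = of_chain l c" by (rule of_chain_surj)
  show "\<delta> l x \<in> carrier (M (l + 1))"
    by (simp add: c \<delta>_of_chain of_chain_closed D_closed)
  {
    fix y assume "y \<in> carrier (M l)"
    then obtain d where d: "d \<in> chains l" "y = of_chain l d" by (rule of_chain_surj)
    show "\<delta> l (x \<oplus>\<^bsub>M l\<^esub> y) = \<delta> l x \<oplus>\<^bsub>M (l + 1)\<^esub> \<delta> l y"
      by (simp add: c d \<delta>_of_chain D_closed lin_ext_add chains_add of_chain_add[symmetric])
  }
  fix a assume "a \<in> carrier A"
  then obtain f where f: "f \<in> carrier kQ" "a = cls f" by (auto simp: carrier_A)
  then obtain d where "d \<in> chains l" "cls f \<odot>\<^bsub>M l\<^esub> of_chain l c = of_chain l d"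
    "cls f \<odot>\<^bsub>M (l + 1)\<^esub> of_chain (l + 1) (D c) = of_chain (l + 1) (D d)"
    using smult_of_chain_D c by blast
  then show "\<delta> l (a \<odot>\<^bsub>M l\<^esub> x) = a \<odot>\<^bsub>M (l + 1)\<^esub> \<delta> l x"
    by (simp add: f c \<delta>_of_chain)
qed

lemma scalar_class_closed: "range (scalar_class k Q) \<subseteq> carrier A"
  using cls_closed[OF idempotents_closed] by (auto simp: scalar_class_def cls_def)

lemma of_chain_sum:
  assumes "finite S" "\<And>x. x \<in> S \<Longrightarrow> f x \<in> chains l"
  shows "of_chain l (sum f S) = finsum (M l) (\<lambda>x. of_chain l (f x)) S"
  using assms
proof (induction S rule: finite_induct)
  case empty
  then show ?case
    using abelian_group.axioms(1)[OF abelian_group_M] by (simp add: abelian_monoid.finsum_empty)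
next
  case (insert x S)
  then show ?case
    using abelian_group.axioms(1)[OF abelian_group_M]
    by (simp add: abelian_monoid.finsum_insert of_chain_closed of_chain_add chains_sum)
qed

text \<open>This yields the uniqueness of the \<open>k\<close>-linear map with prescribed values on the basis. That such maps
  preserve zero is derived from homogeneity for the scalar \<open>0\<close>.\<close>

lemma linear_maps_eq_on_basis:
  assumes f: "f \<in> linear_maps (range (scalar_class k Q)) (M l) (M l')"
    and g: "g \<in> linear_maps (range (scalar_class k Q)) (M l) (M l')"
    and eq: "\<And>b. b \<in> basis l \<Longrightarrow> f (of_chain l (Poly_Mapping.single b 1)) = g (of_chain l (Poly_Mapping.single b 1))"
    and x: "x \<in> carrier (M l)"
  shows "f x = g x"
proof -
  obtain c where c: "c \<in> chains l" "x = of_chain l c" using x by (rule of_chain_surj)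
  have map_zero: "F (of_chain l 0) = of_chain l' 0"
    if F: "F \<in> linear_maps (range (scalar_class k Q)) (M l) (M l')" for F
  proof -
    have "F (of_chain l 0) \<in> carrier (M l')"
      using F of_chain_closed[OF chains_zero] by (auto simp: linear_maps_def simp del: of_chain_zero)
    then obtain d where d: "d \<in> chains l'" "F (of_chain l 0) = of_chain l' d" by (rule of_chain_surj)
    have "F (of_chain l 0) = F (scalar_class k Q 0 \<odot>\<^bsub>M l\<^esub> of_chain l 0)"
      using of_chain_scale[of 0 l 0] by simp
    also have "\<dots> = scalar_class k Q 0 \<odot>\<^bsub>M l'\<^esub> F (of_chain l 0)"
      using F of_chain_closed[OF chains_zero] by (auto simp: linear_maps_def simp del: of_chain_zero)
    also have "\<dots> = of_chain l' 0" using of_chain_scale[OF d(1), of 0] d by simp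
    finally show ?thesis .
  qed
  have "Poly_Mapping.keys c \<subseteq> basis l" using c by (simp add: chains_def)
  then have "f (of_chain l c) = g (of_chain l c)"
  proof (induction rule: additive_induct)
    case zero
    show ?case by (simp only: map_zero[OF f] map_zero[OF g])
  next
    case (single b a)
    have "of_chain l (Poly_Mapping.single b a) =
        scalar_class k Q a \<odot>\<^bsub>M l\<^esub> of_chain l (Poly_Mapping.single b 1)"
      using of_chain_scale[OF chains_single[OF single], of a 1] by simp
    then show ?case
      using f g eq[OF single] of_chain_closed[OF chains_single[OF single]] by (auto simp: linear_maps_def)
  next
    case (add c d)
    then have "c \<in> chains l" "d \<in> chains l" by (simp_all add: chains_def)
    then show ?case
      using f g add of_chain_closed by (auto simp: linear_maps_def of_chain_add)
  qed
  then show ?thesis using c by simp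
qed

text \<open>The conditions that characterise the differential, uniformly in the basis element; \<open>prescribed_iff\<close>
  splits them into those for arrows and those for trivial paths.\<close>

definition prescribed :: "int \<Rightarrow> (('v, 'e, 'k) leavitt_elem \<Rightarrow> ('v, 'e, 'k) leavitt_elem) \<Rightarrow> bool"
  where "prescribed l f \<longleftrightarrow> (\<forall>b\<in>basis l. f (of_chain l (Poly_Mapping.single b 1)) = of_chain (l + 1) (d_basis b))"

lemma prescribed_iff:
  "prescribed l f \<longleftrightarrow> (\<forall>i\<in>verts Q. \<forall>(p, q)\<in>\<Lambda> l i.
        (\<forall>\<alpha>\<in>arcs Q. tail Q \<alpha> = i \<longrightarrow>
          f (zeta k Q assoc_arrow l (arrow_path Q \<alpha>) (p, q)) = \<zero>\<^bsub>M (l + 1)\<^esub>) \<and>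
        f (zeta k Q assoc_arrow l (trivial_path i) (p, q)) =
          (if snd p = []
           then finsum (M (l + 1))
             (\<lambda>\<beta>. zeta k Q assoc_arrow (l + 1) (arrow_path Q \<beta>)
               (trivial_path (tail Q \<beta>), path_comp q (arrow_path Q \<beta>)))
             {\<beta> \<in> arcs Q. head Q \<beta> = i}
           else zeta k Q assoc_arrow (l + 1) (arrow_path Q (last (snd p))) (path_hat p, q)))"
  (is "_ \<longleftrightarrow> (\<forall>i\<in>verts Q. \<forall>(p, q)\<in>\<Lambda> l i. ?arrows i p q \<and> ?trivial i p q)")
proof -
  have arrows: "?arrows i p q \<longleftrightarrow> (\<forall>\<alpha>\<in>arcs Q. tail Q \<alpha> = i \<longrightarrow>
      f (of_chain l (Poly_Mapping.single (arrow_path Q \<alpha>, (p, q)) 1)) =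
      of_chain (l + 1) (d_basis (arrow_path Q \<alpha>, (p, q))))" if "(p, q) \<in> \<Lambda> l i" for i p q
  proof -
    have "(arrow_path Q \<alpha>, (p, q)) \<in> basis l" if "\<alpha> \<in> arcs Q" "tail Q \<alpha> = i" for \<alpha>
      using that \<open>(p, q) \<in> \<Lambda> l i\<close> by (auto simp: basis_def arrow_path_def)
    then show ?thesis by (auto simp: zeta_eq_of_chain) (auto simp: arrow_path_def)
  qed
  have trivial: "?trivial i p q \<longleftrightarrow>
      f (of_chain l (Poly_Mapping.single (trivial_path i, (p, q)) 1)) =
      of_chain (l + 1) (d_basis (trivial_path i, (p, q)))"
    if i: "i \<in> verts Q" and pq: "(p, q) \<in> \<Lambda> l i" for i p q
  proof -
    have b: "(trivial_path i, (p, q)) \<in> basis l"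
      using i pq by (auto simp: basis_def trivial_path_def)
    note d = d_basis_closed[OF b]
    show ?thesis
    proof (cases "snd p = []")
      case True
      let ?S = "{\<beta> \<in> arcs Q. head Q \<beta> = i}"
      let ?b = "\<lambda>\<beta>. (arrow_path Q \<beta>, (trivial_path (tail Q \<beta>), path_comp q (arrow_path Q \<beta>)))"
      obtain w where pq': "p = (i, [])" "q = (i, w)"
        using True pq by (cases p; cases q) (auto simp: mem_index_iff path_target_simp)
      have mem: "?b \<beta> \<in> basis (l + 1)" if "\<beta> \<in> ?S" for \<beta>
        using that pq by (auto simp: pq' basis_def arrow_path_def trivial_path_def path_comp_def
            mem_index_iff path_target_simp)
      have "of_chain (l + 1) (d_basis (trivial_path i, (p, q))) =
          finsum (M (l + 1)) (\<lambda>\<beta>. of_chain (l + 1) (Poly_Mapping.single (?b \<beta>) 1)) ?S"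
        using mem True by (subst of_chain_sum[symmetric]) (auto simp: trivial_path_def intro!: chains_single)
      also have "\<dots> = finsum (M (l + 1)) (\<lambda>\<beta>. zeta k Q assoc_arrow (l + 1) (arrow_path Q \<beta>)
               (trivial_path (tail Q \<beta>), path_comp q (arrow_path Q \<beta>))) ?S"
        using mem of_chain_closed chains_single
        by (intro abelian_monoid.finsum_cong'[OF abelian_group.axioms(1)[OF abelian_group_M]])
          (auto simp: zeta_eq_of_chain)
      finally show ?thesis using True by (simp add: zeta_eq_of_chain[OF b])
    next
      case False
      have "(arrow_path Q (last (snd p)), (path_hat p, q)) \<in> basis (l + 1)"
        using d False by (simp add: chains_def trivial_path_def)
      then show ?thesis using False by (simp add: zeta_eq_of_chain zeta_eq_of_chain[OF b] snd_trivial_path)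
    qed
  qed
  have "prescribed l f \<longleftrightarrow> (\<forall>i\<in>verts Q. \<forall>(p, q)\<in>\<Lambda> l i. \<forall>r\<in>local_basis i.
      f (of_chain l (Poly_Mapping.single (r, (p, q)) 1)) = of_chain (l + 1) (d_basis (r, (p, q))))"
    using path_source_in_verts by (fastforce simp: prescribed_def basis_def local_basis_def)
  also have "\<dots> \<longleftrightarrow> (\<forall>i\<in>verts Q. \<forall>(p, q)\<in>\<Lambda> l i. ?arrows i p q \<and> ?trivial i p q)"
  proof -
    have "local_basis i = insert (trivial_path i) (arrow_path Q ` {\<alpha> \<in> arcs Q. tail Q \<alpha> = i})"
      if "i \<in> verts Q" for i
    proof (intro equalityI subsetI)
      fix r assume "r \<in> local_basis i"
      then show "r \<in> insert (trivial_path i) (arrow_path Q ` {\<alpha> \<in> arcs Q. tail Q \<alpha> = i})"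
        by (cases r; cases "snd r") (auto simp: local_basis_def trivial_path_def arrow_path_def)
    qed (use that in \<open>auto simp: local_basis_def trivial_path_def arrow_path_def\<close>)
    note local_basis_eq = this
    show ?thesis
    proof (intro ball_cong refl)
      fix i pq assume i: "i \<in> verts Q" and pq: "pq \<in> \<Lambda> l i"
      obtain p q where eq: "pq = (p, q)" by (cases pq)
      note mem = pq[unfolded eq]
      show "(case pq of (p, q) \<Rightarrow> \<forall>r\<in>local_basis i.
          f (of_chain l (Poly_Mapping.single (r, (p, q)) 1)) = of_chain (l + 1) (d_basis (r, (p, q)))) =
        (case pq of (p, q) \<Rightarrow> ?arrows i p q \<and> ?trivial i p q)"
        unfolding eq prod.case local_basis_eq[OF i] arrows[OF mem] trivial[OF i mem] by blast
    qed
  qed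
  finally show ?thesis .
qed

lemma \<delta>_prescribed: "prescribed l (\<delta> l)"
  using \<delta>_of_chain[OF chains_single, of _ l 1] by (simp add: prescribed_def del: d_basis.simps)

lemma leavitt_differential_eq: "leavitt_differential k Q assoc_arrow l = \<delta> l"
proof -
  have "leavitt_differential k Q assoc_arrow l = (THE f. f \<in> extensional (carrier (M l)) \<and>
    f \<in> linear_maps (range (scalar_class k Q)) (M l) (M (l + 1)) \<and> prescribed l f)"
    unfolding prescribed_iff by (rule leavitt_differential_def)
  also have "\<dots> = \<delta> l"
  proof (rule the_equality)
    have lin: "\<delta> l \<in> linear_maps (range (scalar_class k Q)) (M l) (M (l + 1))"
      by (rule subsetD[OF linear_maps_antimono[OF scalar_class_closed] \<delta>_linear])
    moreover have ext: "\<delta> l \<in> extensional (carrier (M l))"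
      unfolding \<delta>_def by (rule restrict_extensional)
    ultimately show "\<delta> l \<in> extensional (carrier (M l)) \<and>
        \<delta> l \<in> linear_maps (range (scalar_class k Q)) (M l) (M (l + 1)) \<and> prescribed l (\<delta> l)"
      using \<delta>_prescribed by blast
    fix f
    assume f: "f \<in> extensional (carrier (M l)) \<and>
      f \<in> linear_maps (range (scalar_class k Q)) (M l) (M (l + 1)) \<and> prescribed l f"
    show "f = \<delta> l"
    proof (rule extensionalityI[OF conjunct1[OF f] ext])
      fix x assume x: "x \<in> carrier (M l)"
      have "f (of_chain l (Poly_Mapping.single b 1)) = \<delta> l (of_chain l (Poly_Mapping.single b 1))"
        if "b \<in> basis l" for b
        using f \<delta>_prescribed[of l] that unfolding prescribed_def by metis
      then show "f x = \<delta> l x"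
        using linear_maps_eq_on_basis[OF _ lin _ x] f by blast
    qed
  qed
  finally show ?thesis .
qed

text \<open>A cocycle \<open>c\<close> satisfies \<open>c = D (H c) + H (D c) = D (H c)\<close>.\<close>

lemma acyclic: "acyclic_complex A M (leavitt_differential k Q assoc_arrow)"
  unfolding acyclic_complex_def cochain_complex_def leavitt_differential_eq
proof (intro conjI allI ballI)
  fix l :: int
  have l: "l + 1 + 1 = l + 2" by simp
  show "left_module A (M l)" by (rule left_module_M)
  show "\<delta> l \<in> linear_maps (carrier A) (M l) (M (l + 1))" by (rule \<delta>_linear)
  show \<delta>\<delta>: "\<delta> (l + 1) (\<delta> l x) = \<zero>\<^bsub>M (l + 2)\<^esub>" if x: "x \<in> carrier (M l)" for x
  proof -
    obtain c where "c \<in> chains l" "x = of_chain l c" by (rule of_chain_surj[OF x])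
    then show ?thesis using \<delta>_of_chain[of "D c" "l + 1"] by (simp add: \<delta>_of_chain D_closed D_D l)
  qed
  show "a_kernel (M (l + 1)) (M (l + 2)) (\<delta> (l + 1)) = \<delta> l ` carrier (M l)"
  proof (intro equalityI subsetI)
    fix x assume "x \<in> a_kernel (M (l + 1)) (M (l + 2)) (\<delta> (l + 1))"
    then have x: "x \<in> carrier (M (l + 1))" "\<delta> (l + 1) x = \<zero>\<^bsub>M (l + 2)\<^esub>"
      by (auto simp: a_kernel_def')
    obtain c where c: "c \<in> chains (l + 1)" "x = of_chain (l + 1) c" using x(1) by (rule of_chain_surj)
    have "of_chain (l + 2) (D c) = of_chain (l + 2) 0"
      using x(2) \<delta>_of_chain[OF c(1)] by (simp add: c l)
    then have "D c = 0"
      using D_closed[OF c(1)] by (intro of_chain_inj[of _ "l + 2"]) (auto simp: l)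
    then have "x = \<delta> l (of_chain l (H c))"
      using homotopy[OF c(1)] H_closed[OF c(1)] by (simp add: \<delta>_of_chain c)
    then show "x \<in> \<delta> l ` carrier (M l)"
      using of_chain_closed[OF H_closed[OF c(1)]] by blast
  next
    fix x assume "x \<in> \<delta> l ` carrier (M l)"
    then show "x \<in> a_kernel (M (l + 1)) (M (l + 2)) (\<delta> (l + 1))"
      using \<delta>\<delta> \<delta>_linear[of l] by (auto simp: a_kernel_def' linear_maps_def)
  qed
qed

end

theorem proposition2p7:
  fixes k :: "'k::field itself"
    and Q :: "('v, 'e) pre_digraph"
    and assoc_arrow :: "'v \<Rightarrow> 'e"
  assumes "fin_digraph Q"
    and no_sources: "\<forall>i\<in>verts Q. \<exists>\<alpha>\<in>arcs Q. head Q \<alpha> = i"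
    and associated: "\<forall>i\<in>verts Q. assoc_arrow i \<in> arcs Q \<and> head Q (assoc_arrow i) = i"
  shows "acyclic_complex (rsz_algebra k Q) (leavitt_module k Q assoc_arrow) (leavitt_differential k Q assoc_arrow)"
proof -
  interpret fin_digraph Q by fact
  interpret leavitt_quiver Q k assoc_arrow
    using associated by unfold_locales auto
  show ?thesis by (rule acyclic)
qed

end
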